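(* Let $C_4$ be the 4-cycle graph with vertices $v_1,v_2,v_3,v_4$ and edges $v_1v_2,v_2v_3,v_3v_4,v_4v_1$, let $\lambda$ be a labeling of $C_4$, and let $\mathcal C$ be an algebraic motion of $(C_4,\lambda)$. If $\delta$ is a NAC-coloring of $C_4$ that is active with respect to $\mathcal C$, then $\mu(\delta,\mathcal C)=1$.
   Context: For a graph $G$, a labeling $\lambda\colon E_G\to\mathbb{R}_{>0}$ and a fixed edge $\bar u\bar v$, an algebraic motion of $(G,\lambda)$ is an irreducible algebraic curve $\mathcal C$ in the complex zero set of $x_{\bar u}=y_{\bar u}=0$, $x_{\bar v}=\lambda(\bar u\bar v)$, $y_{\bar v}=0$, $(x_u-x_v)^2+(y_u-y_v)^2=\lambda(uv)^2$ ($uv\in E_G$). $F(\mathcal C)$ is its complex function field; $W_{u,v}=(x_v-x_u)+i(y_v-y_u)$ and for a valuation $\nu$ write $\nu(W_e)$ for $e=uv$. A NAC-coloring is a surjective map $\delta\colon E_G\to\{\text{red},\text{blue}\}$ such that every cycle is monochromatic or has at least two edges of each color; it is active with respect to $\mathcal C$ if there exist a valuation $\nu$ of $F(\mathcal C)$ trivial on $\mathbb{C}$ and $\alpha\in\mathbb{Q}$ with $\delta(uv)=\text{red}$ iff $\nu(W_{u,v})>\alpha$. $\mathrm{Val}(\mathcal C)$ is the set of valuations of $F(\mathcal C)$ trivial on $\mathbb{C}$ and surjective onto $\mathbb{Z}$; $\mathrm{gap}(\delta,\nu)=\max\{0,\min_{\delta(e)=\text{red}}\nu(W_e)-\max_{\delta(e)=\text{blue}}\nu(W_e)\}$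 and $\mu(\delta,\mathcal C)=\sum_{\nu\in\mathrm{Val}(\mathcal C)}\mathrm{gap}(\delta,\nu)$. *)

theory Defs
  imports Complex_Main "HOL-Library.FuncSet" "HOL-Library.Extended_Nat" "HOL-Algebra.Ring"
begin

record 'v graph =
  verts :: "'v set"
  edges :: "'v set set"

definition C4 :: "'v \<Rightarrow> 'v \<Rightarrow> 'v \<Rightarrow> 'v \<Rightarrow> 'v graph" where
  "C4 v1 v2 v3 v4 =
     \<lparr>verts = {v1, v2, v3, v4}, edges = {{v1, v2}, {v2, v3}, {v3, v4}, {v4, v1}}\<rparr>"

definition labeling :: "'v graph \<Rightarrow> ('v set \<Rightarrow> real) \<Rightarrow> bool" where
  "labeling G lam \<longleftrightarrow> (\<forall>e\<in>edges G. lam e > 0)"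


subsection \<open>Affine varieties in the space of placements\<close>

text \<open>A point \<open>\<rho>\<close> assigns to each vertex \<open>w\<close> the coordinates \<open>\<rho> w = (x\<^sub>w, y\<^sub>w)\<close>. Since points are
  extensional on \<open>V\<close>, \<open>affine_space V\<close> is \<open>\<complex>\<close> to the power \<open>2 |V|\<close>. As \<open>\<complex>\<close> is infinite, polynomials in
  the coordinates are identified with the functions that they define.\<close>

type_synonym 'v point = "'v \<Rightarrow> complex \<times> complex"

definition affine_space :: "'v set \<Rightarrow> 'v point set" where
  "affine_space V = V \<rightarrow>\<^sub>E UNIV"

inductive_set polys :: "'v set \<Rightarrow> ('v point \<Rightarrow> complex) set" for V :: "'v set" where
  const: "(\<lambda>_. c) \<in> polys V"
| xcoord: "w \<in> V \<Longrightarrow> (\<lambda>\<rho>. fst (\<rho> w)) \<in> polys V"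
| ycoord: "w \<in> V \<Longrightarrow> (\<lambda>\<rho>. snd (\<rho> w)) \<in> polys V"
| add: "p \<in> polys V \<Longrightarrow> q \<in> polys V \<Longrightarrow> (\<lambda>\<rho>. p \<rho> + q \<rho>) \<in> polys V"
| mult: "p \<in> polys V \<Longrightarrow> q \<in> polys V \<Longrightarrow> (\<lambda>\<rho>. p \<rho> * q \<rho>) \<in> polys V"

definition algebraic_set :: "'v set \<Rightarrow> 'v point set \<Rightarrow> bool" where
  "algebraic_set V Z \<longleftrightarrow>
     (\<exists>P\<subseteq>polys V. Z = {\<rho> \<in> affine_space V. \<forall>p\<in>P. p \<rho> = 0})"

definition irreducible_set :: "'v set \<Rightarrow> 'v point set \<Rightarrow> bool" where
  "irreducible_set V Z \<longleftrightarrow> algebraic_set V Z \<and> Z \<noteq> {} \<and>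
     (\<forall>A B. algebraic_set V A \<and> algebraic_set V B \<and> Z = A \<union> B \<longrightarrow> Z = A \<or> Z = B)"

text \<open>The Krull dimension: the supremum of the lengths of chains of irreducible closed subsets.\<close>

definition variety_dim :: "'v set \<Rightarrow> 'v point set \<Rightarrow> enat" where
  "variety_dim V Z = Sup {enat n |n. \<exists>K :: nat \<Rightarrow> 'v point set.
     (\<forall>i\<le>n. irreducible_set V (K i) \<and> K i \<subseteq> Z) \<and> (\<forall>i<n. K i \<subset> K (Suc i))}"

definition irreducible_curve :: "'v set \<Rightarrow> 'v point set \<Rightarrow> bool" where
  "irreducible_curve V C \<longleftrightarrow> irreducible_set V C \<and> variety_dim V C = 1"


subsection \<open>Function fields and valuations\<close>

definition coordinate_ring :: "'v set \<Rightarrow> 'v point set \<Rightarrow> ('v point \<Rightarrow> complex) ring" where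
  "coordinate_ring V C =
     \<lparr>carrier = (\<lambda>p. restrict p C) ` polys V,
      monoid.mult = (\<lambda>f g. \<lambda>\<rho>\<in>C. f \<rho> * g \<rho>),
      one = (\<lambda>\<rho>\<in>C. 1),
      zero = (\<lambda>\<rho>\<in>C. 0),
      ring.add = (\<lambda>f g. \<lambda>\<rho>\<in>C. f \<rho> + g \<rho>)\<rparr>"

definition frac_rel :: "('a, 'm) ring_scheme \<Rightarrow> (('a \<times> 'a) \<times> ('a \<times> 'a)) set" where
  "frac_rel R = {((a, b), (c, d)). a \<in> carrier R \<and> c \<in> carrier R \<and>
     b \<in> carrier R - {\<zero>\<^bsub>R\<^esub>} \<and> d \<in> carrier R - {\<zero>\<^bsub>R\<^esub>} \<and> a \<otimes>\<^bsub>R\<^esub> d = c \<otimes>\<^bsub>R\<^esub> b}"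

definition fraction :: "('a, 'm) ring_scheme \<Rightarrow> 'a \<Rightarrow> 'a \<Rightarrow> ('a \<times> 'a) set" where
  "fraction R a b = frac_rel R `` {(a, b)}"

definition fraction_field :: "('a, 'm) ring_scheme \<Rightarrow> ('a \<times> 'a) set ring" where
  "fraction_field R =
     \<lparr>carrier = (carrier R \<times> (carrier R - {\<zero>\<^bsub>R\<^esub>})) // frac_rel R,
      monoid.mult = (\<lambda>X Y. \<Union>(a, b)\<in>X. \<Union>(c, d)\<in>Y. fraction R (a \<otimes>\<^bsub>R\<^esub> c) (b \<otimes>\<^bsub>R\<^esub> d)),
      one = fraction R \<one>\<^bsub>R\<^esub> \<one>\<^bsub>R\<^esub>,
      zero = fraction R \<zero>\<^bsub>R\<^esub> \<one>\<^bsub>R\<^esub>,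
      ring.add = (\<lambda>X Y. \<Union>(a, b)\<in>X. \<Union>(c, d)\<in>Y.
        fraction R ((a \<otimes>\<^bsub>R\<^esub> d) \<oplus>\<^bsub>R\<^esub> (c \<otimes>\<^bsub>R\<^esub> b)) (b \<otimes>\<^bsub>R\<^esub> d))\<rparr>"

definition function_field ::
    "'v set \<Rightarrow> 'v point set \<Rightarrow> (('v point \<Rightarrow> complex) \<times> ('v point \<Rightarrow> complex)) set ring" where
  "function_field V C = fraction_field (coordinate_ring V C)"

definition of_poly ::
    "'v set \<Rightarrow> 'v point set \<Rightarrow> ('v point \<Rightarrow> complex) \<Rightarrow>
      (('v point \<Rightarrow> complex) \<times> ('v point \<Rightarrow> complex)) set" where
  "of_poly V C p = fraction (coordinate_ring V C) (restrict p C) (restrict (\<lambda>_. 1) C)"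

text \<open>Valuations are maps on the nonzero elements. Extensionality makes distinct functions distinct
  valuations, so that sums over sets of valuations count each one once.\<close>

definition valuation ::
    "('a, 'm) ring_scheme \<Rightarrow> ('a \<Rightarrow> 'g::linordered_ab_group_add) \<Rightarrow> bool" where
  "valuation F \<nu> \<longleftrightarrow> \<nu> \<in> extensional (carrier F - {\<zero>\<^bsub>F\<^esub>}) \<and>
     (\<forall>a\<in>carrier F - {\<zero>\<^bsub>F\<^esub>}. \<forall>b\<in>carrier F - {\<zero>\<^bsub>F\<^esub>}.
        \<nu> (a \<otimes>\<^bsub>F\<^esub> b) = \<nu> a + \<nu> b \<and>
        (a \<oplus>\<^bsub>F\<^esub> b \<noteq> \<zero>\<^bsub>F\<^esub> \<longrightarrow> \<nu> (a \<oplus>\<^bsub>F\<^esub> b) \<ge> min (\<nu> a) (\<nu> b)))"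

definition trivial_on_constants ::
    "'v set \<Rightarrow> 'v point set \<Rightarrow>
      ((('v point \<Rightarrow> complex) \<times> ('v point \<Rightarrow> complex)) set \<Rightarrow> 'g::linordered_ab_group_add) \<Rightarrow> bool"
  where
  "trivial_on_constants V C \<nu> \<longleftrightarrow> (\<forall>c. c \<noteq> 0 \<longrightarrow> \<nu> (of_poly V C (\<lambda>_. c)) = 0)"

definition Val ::
    "'v set \<Rightarrow> 'v point set \<Rightarrow>
      ((('v point \<Rightarrow> complex) \<times> ('v point \<Rightarrow> complex)) set \<Rightarrow> int) set" where
  "Val V C = {\<nu>. valuation (function_field V C) \<nu> \<and> trivial_on_constants V C \<nu> \<and>
     \<nu> ` (carrier (function_field V C) - {\<zero>\<^bsub>function_field V C\<^esub>}) = UNIV}"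


subsection \<open>Algebraic motions\<close>

definition realizations :: "'v graph \<Rightarrow> ('v set \<Rightarrow> real) \<Rightarrow> 'v \<Rightarrow> 'v \<Rightarrow> 'v point set" where
  "realizations G lam u' v' = {\<rho> \<in> affine_space (verts G).
     \<rho> u' = (0, 0) \<and> \<rho> v' = (complex_of_real (lam {u', v'}), 0) \<and>
     (\<forall>u v. {u, v} \<in> edges G \<longrightarrow>
        (fst (\<rho> u) - fst (\<rho> v))\<^sup>2 + (snd (\<rho> u) - snd (\<rho> v))\<^sup>2 = (complex_of_real (lam {u, v}))\<^sup>2)}"

definition algebraic_motion ::
    "'v graph \<Rightarrow> ('v set \<Rightarrow> real) \<Rightarrow> 'v \<Rightarrow> 'v \<Rightarrow> 'v point set \<Rightarrow> bool" where
  "algebraic_motion G lam u' v' C \<longleftrightarrow>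
     irreducible_curve (verts G) C \<and> C \<subseteq> realizations G lam u' v'"

definition W ::
    "'v set \<Rightarrow> 'v point set \<Rightarrow> 'v \<Rightarrow> 'v \<Rightarrow>
      (('v point \<Rightarrow> complex) \<times> ('v point \<Rightarrow> complex)) set" where
  "W V C u v =
     of_poly V C (\<lambda>\<rho>. (fst (\<rho> v) - fst (\<rho> u)) + \<i> * (snd (\<rho> v) - snd (\<rho> u)))"


subsection \<open>NAC-colorings\<close>

datatype color = Red | Blue

definition cycle :: "'v graph \<Rightarrow> 'v list \<Rightarrow> bool" where
  "cycle G ws \<longleftrightarrow> 3 \<le> length ws \<and> distinct ws \<and> set ws \<subseteq> verts G \<and>
     (\<forall>i<length ws. {ws ! i, ws ! (Suc i mod length ws)} \<in> edges G)"

definition cycle_edges :: "'v list \<Rightarrow> 'v set set" where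
  "cycle_edges ws = {{ws ! i, ws ! (Suc i mod length ws)} |i. i < length ws}"

definition NAC_coloring :: "'v graph \<Rightarrow> ('v set \<Rightarrow> color) \<Rightarrow> bool" where
  "NAC_coloring G \<delta> \<longleftrightarrow> \<delta> ` edges G = {Red, Blue} \<and>
     (\<forall>ws. cycle G ws \<longrightarrow>
        (\<exists>c. \<forall>e\<in>cycle_edges ws. \<delta> e = c) \<or>
        (\<forall>c. 2 \<le> card {e \<in> cycle_edges ws. \<delta> e = c}))"

text \<open>Since \<open>W V C v u\<close> is the negative of \<open>W V C u v\<close>, a valuation takes the same value on both.
  So instead of choosing an orientation of each edge, both are admitted below.\<close>

definition active :: "'v graph \<Rightarrow> 'v point set \<Rightarrow> ('v set \<Rightarrow> color) \<Rightarrow> bool" where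
  "active G C \<delta> \<longleftrightarrow>
     (\<exists>\<nu> (\<alpha>::rat). valuation (function_field (verts G) C) \<nu> \<and>
        trivial_on_constants (verts G) C \<nu> \<and>
        (\<forall>u v. {u, v} \<in> edges G \<longrightarrow> (\<delta> {u, v} = Red \<longleftrightarrow> \<nu> (W (verts G) C u v) > \<alpha>)))"

definition gap ::
    "'v graph \<Rightarrow> 'v point set \<Rightarrow> ('v set \<Rightarrow> color) \<Rightarrow>
      ((('v point \<Rightarrow> complex) \<times> ('v point \<Rightarrow> complex)) set \<Rightarrow> int) \<Rightarrow> int" where
  "gap G C \<delta> \<nu> = max 0
     (Min {\<nu> (W (verts G) C u v) |u v. {u, v} \<in> edges G \<and> \<delta> {u, v} = Red} -
      Max {\<nu> (W (verts G) C u v) |u v. {u, v} \<in> edges G \<and> \<delta> {u, v} = Blue})"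

text \<open>\<open>Val V C\<close> is infinite, hence the restriction to the support of the summands.
  An infinite support would give the value \<open>0\<close>, so \<open>mu G C \<delta> = 1\<close> includes that the support is finite.\<close>

definition mu :: "'v graph \<Rightarrow> 'v point set \<Rightarrow> ('v set \<Rightarrow> color) \<Rightarrow> int" where
  "mu G C \<delta> = (\<Sum>\<nu> | \<nu> \<in> Val (verts G) C \<and> gap G C \<delta> \<nu> \<noteq> 0. gap G C \<delta> \<nu>)"

end

theory Submission
  imports Defs
begin

text \<open>Let \<open>r1\<close>, \<open>r2\<close> be the functions \<open>W\<close> of the red edges and \<open>b1\<close>, \<open>b2\<close> those of the blue
  edges. They satisfy \<open>r1 + r2 + b1 + b2 = 0\<close> and, since \<open>\<lambda>(e)\<^sup>2 / W\<^sub>e\<close> is the conjugate expression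
  \<open>(x\<^sub>v - x\<^sub>u) - i (y\<^sub>v - y\<^sub>u)\<close>, also \<open>\<lambda>(r1)\<^sup>2 / r1 + \<dots> + \<lambda>(b2)\<^sup>2 / b2 = 0\<close>. If \<open>\<nu>\<close> has a positive gap, the
  first equation forces \<open>\<nu> b1 = \<nu> b2\<close> and the second one \<open>\<nu> r1 = \<nu> r2\<close>, so that the gap is \<open>\<nu> q\<close>
  with \<open>q = r1 / b1\<close>. In the coordinates \<open>q\<close>, \<open>r2 / r1\<close>, \<open>b2 / b1\<close> the center of \<open>\<nu>\<close> is the point
  where \<open>q = 0\<close>, \<open>r2 / r1 = - \<lambda>(r2)\<^sup>2 / \<lambda>(r1)\<^sup>2\<close> and \<open>b2 / b1 = - 1\<close>. This point does not depend on \<open>\<nu>\<close>, and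
  the two equations are smooth there with uniformizer \<open>q\<close>. Hence \<open>\<nu>\<close> is \<open>\<nu> q\<close> times the vanishing
  order at this point, so exactly one normalized valuation has a positive gap, and this gap is \<open>1\<close>.\<close>

section \<open>Fraction fields of domains\<close>

text \<open>The operations of \<open>fraction_field\<close> are unions over all pairs of
  representatives. As soon as the resulting class is the same for all of them, such a union
  collapses to that class.\<close>

lemma UN2_eq_const:
  assumes "p \<in> X" "q \<in> Y" "\<And>a b c d. (a, b) \<in> X \<Longrightarrow> (c, d) \<in> Y \<Longrightarrow> f a b c d = E"
  shows "(\<Union>(a, b)\<in>X. \<Union>(c, d)\<in>Y. f a b c d) = E"
proof -
  have "(\<Union>(a, b)\<in>X. \<Union>(c, d)\<in>Y. f a b c d) = (\<Union>x\<in>X. \<Union>y\<in>Y. E)"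
    using assms(3) by (intro SUP_cong refl) (auto split: prod.split)
  also have "\<dots> = E"
    using assms(1,2) by auto
  finally show ?thesis .
qed

context domain
begin

lemma equiv_frac_rel: "equiv (carrier R \<times> (carrier R - {\<zero>})) (frac_rel R)"
proof (rule equivI)
  show "frac_rel R \<subseteq> (carrier R \<times> (carrier R - {\<zero>})) \<times> (carrier R \<times> (carrier R - {\<zero>}))"
    by (auto simp: frac_rel_def)
  show "refl_on (carrier R \<times> (carrier R - {\<zero>})) (frac_rel R)"
    by (auto simp: refl_on_def frac_rel_def)
  show "sym (frac_rel R)"
    by (auto simp: sym_def frac_rel_def)
  show "trans (frac_rel R)"
  proof (rule transI, clarify)
    fix a b c d e f
    assume 1: "((a, b), (c, d)) \<in> frac_rel R" and 2: "((c, d), (e, f)) \<in> frac_rel R"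
    then have cl: "a \<in> carrier R" "b \<in> carrier R" "c \<in> carrier R" "d \<in> carrier R"
        "e \<in> carrier R" "f \<in> carrier R" "b \<noteq> \<zero>" "d \<noteq> \<zero>" "f \<noteq> \<zero>"
      and eq: "a \<otimes> d = c \<otimes> b" "c \<otimes> f = e \<otimes> d"
      by (auto simp: frac_rel_def)
    \<comment> \<open>Transitivity multiplies by the middle denominator \<open>d\<close> and cancels
      it again, which a domain allows.\<close>
    have "d \<otimes> (a \<otimes> f) = (a \<otimes> d) \<otimes> f"
      using cl by (simp add: m_ac)
    also have "\<dots> = (c \<otimes> f) \<otimes> b"
      using cl eq(1) by (simp add: m_ac)
    also have "\<dots> = d \<otimes> (e \<otimes> b)"
      using cl eq(2) by (simp add: m_ac)
    finally have "a \<otimes> f = e \<otimes> b"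
      using cl m_lcancel[of d "a \<otimes> f" "e \<otimes> b"] by simp
    with cl show "((a, b), (e, f)) \<in> frac_rel R"
      by (auto simp: frac_rel_def)
  qed
qed

lemma fraction_eq_iff:
  assumes "a \<in> carrier R" "b \<in> carrier R - {\<zero>}" "c \<in> carrier R" "d \<in> carrier R - {\<zero>}"
  shows "fraction R a b = fraction R c d \<longleftrightarrow> a \<otimes> d = c \<otimes> b"
proof -
  have "fraction R a b = fraction R c d \<longleftrightarrow> ((a, b), (c, d)) \<in> frac_rel R"
    unfolding fraction_def using assms by (intro eq_equiv_class_iff[OF equiv_frac_rel]) auto
  with assms show ?thesis
    by (auto simp: frac_rel_def)
qed

lemma fraction_in_carrier:
  "a \<in> carrier R \<Longrightarrow> b \<in> carrier R - {\<zero>} \<Longrightarrow> fraction R a b \<in> carrier (fraction_field R)"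
  by (auto simp: fraction_field_def fraction_def intro!: quotientI)

lemma fraction_cases:
  assumes "X \<in> carrier (fraction_field R)"
  obtains a b where "a \<in> carrier R" "b \<in> carrier R - {\<zero>}" "X = fraction R a b"
  using assms unfolding fraction_field_def fraction_def by (auto elim!: quotientE)

lemma fraction_eq_zero_iff:
  assumes "a \<in> carrier R" "b \<in> carrier R - {\<zero>}"
  shows "fraction R a b = \<zero>\<^bsub>fraction_field R\<^esub> \<longleftrightarrow> a = \<zero>"
  using assms by (simp add: fraction_field_def fraction_eq_iff)

lemma in_fractionD:
  assumes "(a', b') \<in> fraction R a b"
  shows "a' \<in> carrier R" "b' \<in> carrier R" "b' \<noteq> \<zero>" "a \<otimes> b' = a' \<otimes> b"
  using assms by (auto simp: fraction_def frac_rel_def)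

lemma in_fraction_self:
  "a \<in> carrier R \<Longrightarrow> b \<in> carrier R - {\<zero>} \<Longrightarrow> (a, b) \<in> fraction R a b"
  by (auto simp: fraction_def frac_rel_def)

lemma fraction_mult:
  assumes "a \<in> carrier R" "b \<in> carrier R - {\<zero>}" "c \<in> carrier R" "d \<in> carrier R - {\<zero>}"
  shows "fraction R a b \<otimes>\<^bsub>fraction_field R\<^esub> fraction R c d = fraction R (a \<otimes> c) (b \<otimes> d)"
proof -
  have "fraction R (a' \<otimes> c') (b' \<otimes> d') = fraction R (a \<otimes> c) (b \<otimes> d)"
    if "(a', b') \<in> fraction R a b" "(c', d') \<in> fraction R c d" for a' b' c' d'
  proof -
    note D = in_fractionD[OF that(1)] in_fractionD[OF that(2)]
    have "(a' \<otimes> c') \<otimes> (b \<otimes> d) = (a' \<otimes> b) \<otimes> (c' \<otimes> d)"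
      using D(1-3,5-7) assms by (simp add: m_ac)
    also have "\<dots> = (a \<otimes> b') \<otimes> (c \<otimes> d')"
      by (simp only: D(4,8))
    also have "\<dots> = (a \<otimes> c) \<otimes> (b' \<otimes> d')"
      using D(1-3,5-7) assms by (simp add: m_ac)
    finally have eq: "(a' \<otimes> c') \<otimes> (b \<otimes> d) = (a \<otimes> c) \<otimes> (b' \<otimes> d')" .
    show ?thesis
      by (rule fraction_eq_iff[THEN iffD2, OF _ _ _ _ eq])
        (use D(1-3,5-7) assms in \<open>auto simp: integral_iff\<close>)
  qed
  then have "(\<Union>(a', b')\<in>fraction R a b. \<Union>(c', d')\<in>fraction R c d.
      fraction R (a' \<otimes> c') (b' \<otimes> d')) = fraction R (a \<otimes> c) (b \<otimes> d)"
    using in_fraction_self[OF assms(1,2)] in_fraction_self[OF assms(3,4)]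
    by (intro UN2_eq_const)
  then show ?thesis
    by (simp add: fraction_field_def)
qed

lemma fraction_add:
  assumes "a \<in> carrier R" "b \<in> carrier R - {\<zero>}" "c \<in> carrier R" "d \<in> carrier R - {\<zero>}"
  shows "fraction R a b \<oplus>\<^bsub>fraction_field R\<^esub> fraction R c d
    = fraction R ((a \<otimes> d) \<oplus> (c \<otimes> b)) (b \<otimes> d)"
proof -
  have "fraction R ((a' \<otimes> d') \<oplus> (c' \<otimes> b')) (b' \<otimes> d') = fraction R ((a \<otimes> d) \<oplus> (c \<otimes> b)) (b \<otimes> d)"
    if "(a', b') \<in> fraction R a b" "(c', d') \<in> fraction R c d" for a' b' c' d'
  proof -
    note D = in_fractionD[OF that(1)] in_fractionD[OF that(2)]
    have "((a' \<otimes> d') \<oplus> (c' \<otimes> b')) \<otimes> (b \<otimes> d) = (a' \<otimes> b) \<otimes> (d \<otimes> d') \<oplus> (c' \<otimes> d) \<otimes> (b \<otimes> b')"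
      using D(1-3,5-7) assms by (simp add: l_distr r_distr m_ac)
    also have "\<dots> = (a \<otimes> b') \<otimes> (d \<otimes> d') \<oplus> (c \<otimes> d') \<otimes> (b \<otimes> b')"
      by (simp only: D(4,8))
    also have "\<dots> = ((a \<otimes> d) \<oplus> (c \<otimes> b)) \<otimes> (b' \<otimes> d')"
      using D(1-3,5-7) assms by (simp add: l_distr r_distr m_ac)
    finally have eq: "((a' \<otimes> d') \<oplus> (c' \<otimes> b')) \<otimes> (b \<otimes> d) = ((a \<otimes> d) \<oplus> (c \<otimes> b)) \<otimes> (b' \<otimes> d')" .
    show ?thesis
      by (rule fraction_eq_iff[THEN iffD2, OF _ _ _ _ eq])
        (use D(1-3,5-7) assms in \<open>auto simp: integral_iff\<close>)
  qed
  then have "(\<Union>(a', b')\<in>fraction R a b. \<Union>(c', d')\<in>fraction R c d.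
      fraction R ((a' \<otimes> d') \<oplus> (c' \<otimes> b')) (b' \<otimes> d')) = fraction R ((a \<otimes> d) \<oplus> (c \<otimes> b)) (b \<otimes> d)"
    using in_fraction_self[OF assms(1,2)] in_fraction_self[OF assms(3,4)]
    by (intro UN2_eq_const)
  then show ?thesis
    by (simp add: fraction_field_def)
qed

lemma nonzero_fraction_cases:
  assumes "X \<in> carrier (fraction_field R) - {\<zero>\<^bsub>fraction_field R\<^esub>}"
  obtains a b where "a \<in> carrier R - {\<zero>}" "b \<in> carrier R - {\<zero>}" "X = fraction R a b"
  using assms by (metis Diff_iff fraction_cases fraction_eq_zero_iff insertCI singletonD)

lemma fraction_nonzero:
  "a \<in> carrier R - {\<zero>} \<Longrightarrow> b \<in> carrier R - {\<zero>} \<Longrightarrow>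
    fraction R a b \<in> carrier (fraction_field R) - {\<zero>\<^bsub>fraction_field R\<^esub>}"
  by (simp add: fraction_eq_zero_iff fraction_in_carrier)

lemma fraction_field_mult_nonzero:
  assumes "X \<in> carrier (fraction_field R) - {\<zero>\<^bsub>fraction_field R\<^esub>}"
    and "Y \<in> carrier (fraction_field R) - {\<zero>\<^bsub>fraction_field R\<^esub>}"
  shows "X \<otimes>\<^bsub>fraction_field R\<^esub> Y \<in> carrier (fraction_field R) - {\<zero>\<^bsub>fraction_field R\<^esub>}"
proof -
  obtain a b c d where *: "a \<in> carrier R - {\<zero>}" "b \<in> carrier R - {\<zero>}" "X = fraction R a b"
      "c \<in> carrier R - {\<zero>}" "d \<in> carrier R - {\<zero>}" "Y = fraction R c d"
    using assms by (meson nonzero_fraction_cases)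
  then show ?thesis
    using fraction_nonzero[of "a \<otimes> c" "b \<otimes> d"] by (auto simp: fraction_mult integral_iff)
qed

lemma fraction_field_add_closed:
  assumes "X \<in> carrier (fraction_field R)" "Y \<in> carrier (fraction_field R)"
  shows "X \<oplus>\<^bsub>fraction_field R\<^esub> Y \<in> carrier (fraction_field R)"
proof -
  obtain a b c d where *: "a \<in> carrier R" "b \<in> carrier R - {\<zero>}" "X = fraction R a b"
      "c \<in> carrier R" "d \<in> carrier R - {\<zero>}" "Y = fraction R c d"
    using assms by (meson fraction_cases)
  then show ?thesis
    using fraction_in_carrier[of "a \<otimes> d \<oplus> c \<otimes> b" "b \<otimes> d"] by (auto simp: fraction_add integral_iff)
qed

text \<open>Multiply the fraction by its denominator. Values on ring elements thus determine the
  values on all nonzero fractions.\<close>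

lemma valuation_fraction:
  assumes "valuation (fraction_field R) \<nu>" "a \<in> carrier R - {\<zero>}" "b \<in> carrier R - {\<zero>}"
  shows "\<nu> (fraction R a b) = \<nu> (fraction R a \<one>) - \<nu> (fraction R b \<one>)"
proof -
  have one: "\<one> \<in> carrier R - {\<zero>}"
    by simp
  have "fraction R a b \<otimes>\<^bsub>fraction_field R\<^esub> fraction R b \<one> = fraction R a \<one>"
    using assms(2,3) by (subst fraction_mult) (auto simp: fraction_eq_iff m_ac integral_iff)
  then have "\<nu> (fraction R a \<one>) = \<nu> (fraction R a b) + \<nu> (fraction R b \<one>)"
    using assms(1) fraction_nonzero[OF assms(2,3)] fraction_nonzero[OF assms(3) one]
    unfolding valuation_def by metis
  then show ?thesis
    by simp
qed

end

section \<open>Coordinate rings of irreducible sets\<close>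

lemma algebraic_set_Int_zeros:
  assumes "algebraic_set V Z" "p \<in> polys V"
  shows "algebraic_set V {\<rho> \<in> Z. p \<rho> = 0}"
proof -
  obtain P where "P \<subseteq> polys V" "Z = {\<rho> \<in> affine_space V. \<forall>p\<in>P. p \<rho> = 0}"
    using assms(1) by (auto simp: algebraic_set_def)
  then show ?thesis
    using assms(2) unfolding algebraic_set_def by (intro exI[of _ "insert p P"]) auto
qed

text \<open>If the product vanishes on \<open>C\<close>, the zero sets of \<open>p\<close> and
  \<open>q\<close> in \<open>C\<close> are two algebraic sets that cover \<open>C\<close>, and
  irreducibility makes one of them all of \<open>C\<close>.\<close>

lemma irreducible_set_integral:
  assumes "irreducible_set V C" "p \<in> polys V" "q \<in> polys V" "\<forall>\<rho>\<in>C. p \<rho> * q \<rho> = 0"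
  shows "(\<forall>\<rho>\<in>C. p \<rho> = 0) \<or> (\<forall>\<rho>\<in>C. q \<rho> = 0)"
proof -
  have "C = {\<rho>\<in>C. p \<rho> = 0} \<union> {\<rho>\<in>C. q \<rho> = 0}"
    using assms(4) by auto
  moreover have "algebraic_set V {\<rho>\<in>C. p \<rho> = 0}" "algebraic_set V {\<rho>\<in>C. q \<rho> = 0}"
    using assms(1-3) by (auto simp: irreducible_set_def intro: algebraic_set_Int_zeros)
  ultimately have "C = {\<rho>\<in>C. p \<rho> = 0} \<or> C = {\<rho>\<in>C. q \<rho> = 0}"
    using assms(1) unfolding irreducible_set_def by blast
  then show ?thesis
    by blast
qed

lemma polys_uminus: "p \<in> polys V \<Longrightarrow> (\<lambda>\<rho>. - p \<rho>) \<in> polys V"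
  using polys.mult[OF polys.const[of "-1"]] by simp

lemma polys_diff: "p \<in> polys V \<Longrightarrow> q \<in> polys V \<Longrightarrow> (\<lambda>\<rho>. p \<rho> - q \<rho>) \<in> polys V"
  using polys.add[OF _ polys_uminus] by simp

lemma coordinate_ring_simps:
  "carrier (coordinate_ring V C) = (\<lambda>p. restrict p C) ` polys V"
  "\<one>\<^bsub>coordinate_ring V C\<^esub> = (\<lambda>\<rho>\<in>C. 1)"
  "\<zero>\<^bsub>coordinate_ring V C\<^esub> = (\<lambda>\<rho>\<in>C. 0)"
  "restrict p C \<otimes>\<^bsub>coordinate_ring V C\<^esub> restrict q C = (\<lambda>\<rho>\<in>C. p \<rho> * q \<rho>)"
  "restrict p C \<oplus>\<^bsub>coordinate_ring V C\<^esub> restrict q C = (\<lambda>\<rho>\<in>C. p \<rho> + q \<rho>)"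
  by (auto simp: coordinate_ring_def)

lemma restrict_eq_iff: "restrict f C = restrict g C \<longleftrightarrow> (\<forall>\<rho>\<in>C. f \<rho> = g \<rho>)"
  by (auto simp: restrict_def fun_eq_iff)

lemma domain_coordinate_ring:
  assumes "irreducible_set V C"
  shows "domain (coordinate_ring V C)"
proof -
  let ?R = "coordinate_ring V C"
  have cl: "restrict p C \<in> carrier ?R" if "p \<in> polys V" for p
    using that by (auto simp: coordinate_ring_simps)
  have "abelian_group ?R"
  proof (rule abelian_groupI)
    fix x assume "x \<in> carrier ?R"
    then obtain p where p: "p \<in> polys V" "x = restrict p C"
      by (auto simp: coordinate_ring_simps)
    have "restrict (\<lambda>\<rho>. - p \<rho>) C \<oplus>\<^bsub>?R\<^esub> x = \<zero>\<^bsub>?R\<^esub>"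
      by (simp add: p coordinate_ring_simps)
    then show "\<exists>y\<in>carrier ?R. y \<oplus>\<^bsub>?R\<^esub> x = \<zero>\<^bsub>?R\<^esub>"
      using cl[OF polys_uminus[OF p(1)]] by blast
  qed (auto simp: coordinate_ring_simps restrict_eq_iff polys.const polys.add algebra_simps
      intro!: imageI)
  moreover have "comm_monoid ?R"
    by (rule comm_monoidI)
      (auto simp: coordinate_ring_simps restrict_eq_iff polys.const polys.mult algebra_simps
      intro!: imageI)
  ultimately have "cring ?R"
    by (rule cringI) (auto simp: coordinate_ring_simps restrict_eq_iff algebra_simps)
  then show ?thesis
  proof (rule domain.intro)
    have "C \<noteq> {}"
      using assms by (simp add: irreducible_set_def)
    moreover have "x = \<zero>\<^bsub>?R\<^esub> \<or> y = \<zero>\<^bsub>?R\<^esub>"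
      if xy: "x \<otimes>\<^bsub>?R\<^esub> y = \<zero>\<^bsub>?R\<^esub>" "x \<in> carrier ?R" "y \<in> carrier ?R" for x y
    proof -
      obtain p q where pq: "p \<in> polys V" "q \<in> polys V" "x = restrict p C" "y = restrict q C"
        using xy(2,3) by (auto simp: coordinate_ring_simps)
      then have "\<forall>\<rho>\<in>C. p \<rho> * q \<rho> = 0"
        using xy(1) by (simp add: coordinate_ring_simps restrict_eq_iff)
      then show ?thesis
        using irreducible_set_integral[OF assms pq(1,2)]
        by (simp add: pq coordinate_ring_simps restrict_eq_iff)
    qed
    ultimately show "domain_axioms ?R"
      by (intro domain_axioms.intro) (auto simp: coordinate_ring_simps restrict_eq_iff)
  qed
qed

section \<open>Valuations on rings of functions\<close>

text \<open>An integral domain of functions on \<open>C\<close>, carried by functions on the whole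
  type. By \<open>cong_closed\<close> membership depends only on the values on \<open>C\<close>, so
  plain lambda terms serve as ring elements without being restricted.\<close>

locale function_ring =
  fixes C :: "'a set" and K :: "('a \<Rightarrow> complex) set"
  assumes const_closed: "(\<lambda>_. c) \<in> K"
    and add_closed: "f \<in> K \<Longrightarrow> g \<in> K \<Longrightarrow> (\<lambda>x. f x + g x) \<in> K"
    and mult_closed: "f \<in> K \<Longrightarrow> g \<in> K \<Longrightarrow> (\<lambda>x. f x * g x) \<in> K"
    and cong_closed: "f \<in> K \<Longrightarrow> (\<And>x. x \<in> C \<Longrightarrow> f x = g x) \<Longrightarrow> g \<in> K"
    and integral: "f \<in> K \<Longrightarrow> g \<in> K \<Longrightarrow> \<exists>x\<in>C. f x \<noteq> 0 \<Longrightarrow> \<exists>x\<in>C. g x \<noteq> 0 \<Longrightarrow>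
      \<exists>x\<in>C. f x * g x \<noteq> 0"
    and nonempty: "C \<noteq> {}"
begin

definition nz :: "('a \<Rightarrow> complex) \<Rightarrow> bool" where
  "nz f \<longleftrightarrow> (\<exists>x\<in>C. f x \<noteq> 0)"

lemma nz_const [simp]: "nz (\<lambda>_. c) \<longleftrightarrow> c \<noteq> 0"
  using nonempty by (auto simp: nz_def)

lemma nz_mult: "f \<in> K \<Longrightarrow> g \<in> K \<Longrightarrow> nz (\<lambda>x. f x * g x) \<longleftrightarrow> nz f \<and> nz g"
  using integral[of f g] by (auto simp: nz_def)

lemma nz_cong: "(\<And>x. x \<in> C \<Longrightarrow> f x = g x) \<Longrightarrow> nz f \<longleftrightarrow> nz g"
  by (auto simp: nz_def)

lemma power_closed: "f \<in> K \<Longrightarrow> (\<lambda>x. f x ^ n) \<in> K"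
  by (induction n) (simp_all add: const_closed mult_closed)

lemma uminus_closed: "f \<in> K \<Longrightarrow> (\<lambda>x. - f x) \<in> K"
  using mult_closed[OF const_closed[of "-1"]] by simp

lemma nz_power: "f \<in> K \<Longrightarrow> nz f \<Longrightarrow> nz (\<lambda>x. f x ^ n)"
  by (induction n) (simp_all add: nz_mult power_closed)

end

text \<open>Rational values cover both kinds of valuations that occur: those of
  \<open>active\<close> directly, and the integral ones of \<open>Val\<close> through
  \<open>of_int\<close>. The axioms for sums and products ask for \<open>nz\<close>, as the zero
  function has no meaningful value.\<close>

locale fun_valuation = function_ring C K for C :: "'a set" and K +
  fixes w :: "('a \<Rightarrow> complex) \<Rightarrow> rat"
  assumes val_mult: "f \<in> K \<Longrightarrow> g \<in> K \<Longrightarrow> nz f \<Longrightarrow> nz g \<Longrightarrow> w (\<lambda>x. f x * g x) = w f + w g"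
    and val_add: "f \<in> K \<Longrightarrow> g \<in> K \<Longrightarrow> nz f \<Longrightarrow> nz g \<Longrightarrow> nz (\<lambda>x. f x + g x) \<Longrightarrow>
      min (w f) (w g) \<le> w (\<lambda>x. f x + g x)"
    and val_const: "c \<noteq> 0 \<Longrightarrow> w (\<lambda>_. c) = 0"
    and val_cong: "f \<in> K \<Longrightarrow> (\<And>x. x \<in> C \<Longrightarrow> f x = g x) \<Longrightarrow> w f = w g"
begin

lemma val_power: "f \<in> K \<Longrightarrow> nz f \<Longrightarrow> w (\<lambda>x. f x ^ n) = of_nat n * w f"
  by (induction n) (simp_all add: val_const val_mult power_closed nz_power distrib_right)

lemma val_inverse:
  assumes "f \<in> K" "g \<in> K" "\<And>x. x \<in> C \<Longrightarrow> f x * g x = c" "c \<noteq> 0"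
  shows "w g = - w f" "nz f" "nz g"
proof -
  obtain x where x: "x \<in> C"
    using nonempty by blast
  show nz: "nz f" "nz g"
    using assms(3)[OF x] assms(4) x by (auto simp: nz_def)
  have "w (\<lambda>x. f x * g x) = w (\<lambda>_. c)"
    using assms by (intro val_cong mult_closed) auto
  then show "w g = - w f"
    using val_mult[OF assms(1,2) nz] assms(4) by (simp add: val_const)
qed

lemma val_scale: "f \<in> K \<Longrightarrow> nz f \<Longrightarrow> c \<noteq> 0 \<Longrightarrow> w (\<lambda>x. c * f x) = w f"
  by (simp add: val_mult const_closed val_const)

lemma val_uminus: "f \<in> K \<Longrightarrow> nz f \<Longrightarrow> w (\<lambda>x. - f x) = w f"
  using val_scale[of f "-1"] by simp

text \<open>The bounds are required of nonvanishing summands only, so that a zero summand behaves as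
  if its value were infinite.\<close>

lemma val_add_greater:
  assumes "f \<in> K" "g \<in> K" "nz f \<Longrightarrow> t < w f" "nz g \<Longrightarrow> t < w g" "nz (\<lambda>x. f x + g x)"
  shows "t < w (\<lambda>x. f x + g x)"
proof (cases "nz f \<and> nz g")
  case True
  then show ?thesis
    using val_add[OF assms(1,2)] assms(3-5) by (fastforce simp: min_le_iff_disj)
next
  case False
  then consider "\<forall>x\<in>C. f x = 0" | "\<forall>x\<in>C. g x = 0"
    by (auto simp: nz_def)
  then show ?thesis
  proof cases
    case 1
    then have "w g = w (\<lambda>x. f x + g x)" "nz g"
      using assms(2,5) by (auto intro!: val_cong simp: nz_def)
    then show ?thesis
      using assms(4) by simp
  next
    case 2
    then have "w f = w (\<lambda>x. f x + g x)" "nz f"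
      using assms(1,5) by (auto intro!: val_cong simp: nz_def)
    then show ?thesis
      using assms(3) by simp
  qed
qed

text \<open>If \<open>c + f\<close> had positive value, then so would
  \<open>c = (c + f) - f\<close>, but a nonzero constant has value 0.\<close>

lemma val_const_add:
  assumes "f \<in> K" "nz f \<Longrightarrow> 0 < w f" "c \<noteq> 0"
  shows "nz (\<lambda>x. c + f x)" "w (\<lambda>x. c + f x) = 0"
proof -
  have cf: "(\<lambda>x. c + f x) \<in> K" "(\<lambda>x. - f x) \<in> K"
    using assms(1) by (simp_all add: add_closed const_closed uminus_closed)
  show nz: "nz (\<lambda>x. c + f x)"
  proof (rule ccontr)
    assume "\<not> nz (\<lambda>x. c + f x)"
    then have "f x = - c" if "x \<in> C" for x
      using that by (auto simp: nz_def eq_neg_iff_add_eq_0 add.commute)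
    then have "w f = w (\<lambda>_. - c)" "nz f \<longleftrightarrow> nz (\<lambda>_. - c)"
      using val_cong[OF assms(1), of "\<lambda>_. - c"] nz_cong[of f "\<lambda>_. - c"] by blast+
    then show False
      using assms by (simp add: val_const)
  qed
  have "\<not> 0 < w (\<lambda>x. c + f x)"
  proof
    assume "0 < w (\<lambda>x. c + f x)"
    moreover have "nz (\<lambda>x. - f x) \<longleftrightarrow> nz f"
      by (simp add: nz_def)
    ultimately have "0 < w (\<lambda>x. (c + f x) + - f x)"
      using assms by (intro val_add_greater[OF cf]) (simp_all add: val_uminus)
    then show False
      using assms(3) by (simp add: val_const)
  qed
  moreover have "\<not> w (\<lambda>x. c + f x) < 0"
  proof
    assume *: "w (\<lambda>x. c + f x) < 0"
    \<comment> \<open>The bound \<open>t\<close> of \<open>val_add_greater\<close> is the value of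
      the sum itself: being negative, it lies below the values of both summands and hence below
      itself.\<close>
    then have "w (\<lambda>x. c + f x) < w (\<lambda>x. c + f x)"
      using assms nz by (intro val_add_greater) (auto simp: const_closed val_const)
    then show False
      by simp
  qed
  ultimately show "w (\<lambda>x. c + f x) = 0"
    by simp
qed

text \<open>The other three terms add up to \<open>- f\<close>, yet their sum would have a value
  greater than that of \<open>f\<close>.\<close>

lemma val_sum_zero_not_less:
  assumes "f \<in> K" "g \<in> K" "h \<in> K" "k \<in> K" "\<And>x. x \<in> C \<Longrightarrow> f x + g x + h x + k x = 0"
    and "nz f" "w f < w g" "w f < w h" "w f < w k"
  shows False
proof -
  have eq: "(g x + h x) + k x = - f x" if "x \<in> C" for x
    using assms(5)[OF that] by (simp add: eq_neg_iff_add_eq_0 algebra_simps)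
  then have *: "w (\<lambda>x. (g x + h x) + k x) = w (\<lambda>x. - f x)" "nz (\<lambda>x. (g x + h x) + k x)"
    using assms(2-4,6) by (auto intro!: val_cong add_closed simp: nz_def)
  have "w f < w (\<lambda>x. (g x + h x) + k x)"
    using assms * by (intro val_add_greater add_closed) auto
  then show False
    using * assms by (simp add: val_uminus)
qed

end

section \<open>The local ring at the center\<close>

text \<open>The cycle enters only through two vanishing sums, which are symmetric in the four edges.
  This treats adjacent and opposite red edges alike. The coefficients stand for the squared edge
  lengths.\<close>

locale quadrilateral = function_ring C K for C :: "'a set" and K +
  fixes r1 r2 b1 b2 :: "'a \<Rightarrow> complex" and lr1 lr2 lb1 lb2 :: complex
  assumes unit: "f \<in> {r1, r2, b1, b2} \<Longrightarrow> x \<in> C \<Longrightarrow> f x \<noteq> 0"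
    and edge_closed: "f \<in> {r1, r2, b1, b2} \<Longrightarrow> f \<in> K"
    and inverse_closed: "f \<in> {r1, r2, b1, b2} \<Longrightarrow> (\<lambda>x. inverse (f x)) \<in> K"
    and coeff_nonzero: "lr1 \<noteq> 0" "lr2 \<noteq> 0" "lb1 \<noteq> 0" "lb2 \<noteq> 0"
    and sum_zero: "x \<in> C \<Longrightarrow> r1 x + r2 x + b1 x + b2 x = 0"
    and inverse_sum_zero: "x \<in> C \<Longrightarrow> lr1 / r1 x + lr2 / r2 x + lb1 / b1 x + lb2 / b2 x = 0"
begin

abbreviation q :: "'a \<Rightarrow> complex" where
  "q \<equiv> \<lambda>x. r1 x / b1 x"

text \<open>The polynomial expressions in \<open>q\<close> and in the two ratios that are units at
  the center, together with the inverses of these ratios. No further units are inverted; what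
  matters is that division by \<open>q\<close> with a constant remainder stays inside this
  ring.\<close>

inductive_set local_ring :: "('a \<Rightarrow> complex) set" where
  lconst: "(\<lambda>_. c) \<in> local_ring"
| lr21: "(\<lambda>x. r2 x / r1 x) \<in> local_ring"
| lr12: "(\<lambda>x. r1 x / r2 x) \<in> local_ring"
| lb21: "(\<lambda>x. b2 x / b1 x) \<in> local_ring"
| lb12: "(\<lambda>x. b1 x / b2 x) \<in> local_ring"
| lq: "q \<in> local_ring"
| ladd: "f \<in> local_ring \<Longrightarrow> g \<in> local_ring \<Longrightarrow> (\<lambda>x. f x + g x) \<in> local_ring"
| lmult: "f \<in> local_ring \<Longrightarrow> g \<in> local_ring \<Longrightarrow> (\<lambda>x. f x * g x) \<in> local_ring"

lemma quotient_closed: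
  "f \<in> {r1, r2, b1, b2} \<Longrightarrow> g \<in> {r1, r2, b1, b2} \<Longrightarrow> (\<lambda>x. f x / g x) \<in> K"
  using mult_closed[OF edge_closed inverse_closed, of f g] by (simp add: divide_inverse)

lemma local_ring_subset: "f \<in> local_ring \<Longrightarrow> f \<in> K"
  by (induction rule: local_ring.induct)
    (auto intro: const_closed add_closed mult_closed quotient_closed)

lemma nz_unit: "f \<in> {r1, r2, b1, b2} \<Longrightarrow> nz f"
  using unit nonempty by (auto simp: nz_def)

lemma nz_quotient: "f \<in> {r1, r2, b1, b2} \<Longrightarrow> g \<in> {r1, r2, b1, b2} \<Longrightarrow> nz (\<lambda>x. f x / g x)"
  using unit nonempty by (fastforce simp: nz_def)

lemma q_closed: "q \<in> K" and nz_q: "nz q"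
  by (simp_all add: quotient_closed nz_quotient)

lemma local_ring_decompI:
  "h \<in> local_ring \<Longrightarrow> (\<And>x. x \<in> C \<Longrightarrow> f x = c + q x * h x) \<Longrightarrow>
    \<exists>c. \<exists>h\<in>local_ring. \<forall>x\<in>C. f x = c + q x * h x"
  by blast

text \<open>The functions \<open>b2 / b1\<close> and \<open>r2 / r1\<close> take the values \<open>- 1\<close> and \<open>- lr2 / lr1\<close> where \<open>q\<close>
  vanishes. The two equations, solved for the deviations from these values, show that these
  deviations are multiples of \<open>q\<close>, so that \<open>q\<close> is a uniformizer.\<close>

lemma local_ring_decomp: "f \<in> local_ring \<Longrightarrow> \<exists>c. \<exists>h\<in>local_ring. \<forall>x\<in>C. f x = c + q x * h x"
proof (induction rule: local_ring.induct)
  case (lconst c)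
  show ?case
    by (rule exI[of _ c], rule bexI[OF _ local_ring.lconst[of 0]]) simp
next
  case lr21
  \<comment> \<open>The second equation times \<open>r2 / lr1\<close> expresses
    \<open>r2 / r1 + lr2 / lr1\<close> through \<open>r2 / b1 = q * (r2 / r1)\<close> and
    \<open>r2 / b2 = q * (r2 / r1) * (b1 / b2)\<close>. The cofactor of \<open>q\<close> is the
    witness.\<close>
  have "(\<lambda>x. (- 1 / lr1) * ((r2 x / r1 x) * (lb1 + lb2 * (b1 x / b2 x)))) \<in> local_ring"
    by (intro local_ring.intros)
  moreover have "r2 x / r1 x
      = - lr2 / lr1 + q x * ((- 1 / lr1) * ((r2 x / r1 x) * (lb1 + lb2 * (b1 x / b2 x))))"
    if x: "x \<in> C" for x
  proof -
    have nz: "r1 x \<noteq> 0" "r2 x \<noteq> 0" "b1 x \<noteq> 0" "b2 x \<noteq> 0"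
      using unit x by auto
    have "q x * ((- 1 / lr1) * ((r2 x / r1 x) * (lb1 + lb2 * (b1 x / b2 x))))
      = - (r2 x / lr1) * (lb1 / b1 x + lb2 / b2 x)"
      using nz coeff_nonzero by (simp add: field_simps)
    also have "lb1 / b1 x + lb2 / b2 x = - (lr1 / r1 x + lr2 / r2 x)"
      using inverse_sum_zero[OF x] by (simp add: eq_neg_iff_add_eq_0 algebra_simps)
    also have "- (r2 x / lr1) * - (lr1 / r1 x + lr2 / r2 x) = r2 x / r1 x + lr2 / lr1"
      using nz coeff_nonzero by (simp add: field_simps)
    finally show ?thesis
      by simp
  qed
  ultimately show ?case
    by (rule local_ring_decompI)
next
  case lr12
  have "(\<lambda>x. (- 1 / lr2) * (lb1 + lb2 * (b1 x / b2 x))) \<in> local_ring"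
    by (intro local_ring.intros)
  moreover have "r1 x / r2 x = - lr1 / lr2 + q x * ((- 1 / lr2) * (lb1 + lb2 * (b1 x / b2 x)))"
    if x: "x \<in> C" for x
  proof -
    have nz: "r1 x \<noteq> 0" "r2 x \<noteq> 0" "b1 x \<noteq> 0" "b2 x \<noteq> 0"
      using unit x by auto
    have "q x * ((- 1 / lr2) * (lb1 + lb2 * (b1 x / b2 x)))
      = - (r1 x / lr2) * (lb1 / b1 x + lb2 / b2 x)"
      using nz coeff_nonzero by (simp add: field_simps)
    also have "lb1 / b1 x + lb2 / b2 x = - (lr1 / r1 x + lr2 / r2 x)"
      using inverse_sum_zero[OF x] by (simp add: eq_neg_iff_add_eq_0 algebra_simps)
    also have "- (r1 x / lr2) * - (lr1 / r1 x + lr2 / r2 x) = r1 x / r2 x + lr1 / lr2"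
      using nz coeff_nonzero by (simp add: field_simps)
    finally show ?thesis
      by simp
  qed
  ultimately show ?case
    by (rule local_ring_decompI)
next
  case lb21
  have "(\<lambda>x. - 1 * (1 + r2 x / r1 x)) \<in> local_ring"
    by (intro local_ring.intros)
  moreover have "b2 x / b1 x = - 1 + q x * (- 1 * (1 + r2 x / r1 x))" if x: "x \<in> C" for x
  proof -
    have nz: "r1 x \<noteq> 0" "b1 x \<noteq> 0"
      using unit x by auto
    have "q x * (- 1 * (1 + r2 x / r1 x)) = - (r1 x + r2 x) / b1 x"
      using nz by (simp add: field_simps)
    also have "- (r1 x + r2 x) = b1 x + b2 x"
      using sum_zero[OF x] by (simp add: neg_eq_iff_add_eq_0 algebra_simps)
    also have "(b1 x + b2 x) / b1 x = 1 + b2 x / b1 x"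
      using nz by (simp add: field_simps)
    finally show ?thesis
      by simp
  qed
  ultimately show ?case
    by (rule local_ring_decompI)
next
  case lb12
  have "(\<lambda>x. - 1 * ((b1 x / b2 x) * (1 + r2 x / r1 x))) \<in> local_ring"
    by (intro local_ring.intros)
  moreover have "b1 x / b2 x = - 1 + q x * (- 1 * ((b1 x / b2 x) * (1 + r2 x / r1 x)))"
    if x: "x \<in> C" for x
  proof -
    have nz: "r1 x \<noteq> 0" "r2 x \<noteq> 0" "b1 x \<noteq> 0" "b2 x \<noteq> 0"
      using unit x by auto
    have "q x * (- 1 * ((b1 x / b2 x) * (1 + r2 x / r1 x))) = - (r1 x + r2 x) / b2 x"
      using nz by (simp add: field_simps)
    also have "- (r1 x + r2 x) = b1 x + b2 x"
      using sum_zero[OF x] by (simp add: neg_eq_iff_add_eq_0 algebra_simps)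
    also have "(b1 x + b2 x) / b2 x = b1 x / b2 x + 1"
      using nz by (simp add: field_simps)
    finally show ?thesis
      by simp
  qed
  ultimately show ?case
    by (rule local_ring_decompI)
next
  case lq
  show ?case
    by (rule exI[of _ 0], rule bexI[OF _ local_ring.lconst[of 1]]) simp
next
  case (ladd f g)
  then obtain c d h k where hk: "h \<in> local_ring" "k \<in> local_ring"
      "\<forall>x\<in>C. f x = c + q x * h x" "\<forall>x\<in>C. g x = d + q x * k x"
    by blast
  have "(c + Q * s) + (d + Q * t) = (c + d) + Q * (s + t)" for Q s t :: complex
    by (simp add: algebra_simps)
  then have "f x + g x = (c + d) + q x * (h x + k x)" if "x \<in> C" for x
    using hk(3,4) that by (simp only:)
  then show ?case
    by (rule local_ring_decompI[OF local_ring.ladd[OF hk(1,2)]])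
next
  case (lmult f g)
  then obtain c d h k where hk: "h \<in> local_ring" "k \<in> local_ring"
      "\<forall>x\<in>C. f x = c + q x * h x" "\<forall>x\<in>C. g x = d + q x * k x"
    by blast
  have "(c + Q * s) * (d + Q * t) = c * d + Q * ((c * t + d * s) + Q * (s * t))"
    for Q s t :: complex
    by (simp add: algebra_simps)
  then have "f x * g x = c * d + q x * ((c * k x + d * h x) + q x * (h x * k x))"
    if "x \<in> C" for x
    using hk(3,4) that by (simp only:)
  moreover have "(\<lambda>x. (c * k x + d * h x) + q x * (h x * k x)) \<in> local_ring"
    by (intro local_ring.intros hk(1,2))
  ultimately show ?case
    by (intro local_ring_decompI)
qed

text \<open>Thus \<open>f\<close> is a power of \<open>q\<close> with exponent
  \<open>n = m - k\<close> times a function that is nonzero at the center; the factor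
  \<open>q ^ k\<close> on the left admits negative exponents. No valuation occurs here, so different
  valuations can be compared through the same \<open>n\<close>.\<close>

definition order_at :: "('a \<Rightarrow> complex) \<Rightarrow> int \<Rightarrow> bool" where
  "order_at f n \<longleftrightarrow> (\<exists>k m c. \<exists>h\<in>local_ring. n = int m - int k \<and> c \<noteq> 0 \<and>
     (\<forall>x\<in>C. q x ^ k * f x = q x ^ m * (c + q x * h x)))"

text \<open>Membership in \<open>local_ring\<close> with \<open>q\<close> inverted.\<close>

definition laurent :: "('a \<Rightarrow> complex) \<Rightarrow> bool" where
  "laurent f \<longleftrightarrow> (\<exists>k. \<exists>g\<in>local_ring. \<forall>x\<in>C. q x ^ k * f x = g x)"

lemma laurentI: "g \<in> local_ring \<Longrightarrow> (\<And>x. x \<in> C \<Longrightarrow> q x ^ k * f x = g x) \<Longrightarrow> laurent f"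
  unfolding laurent_def by blast

lemma laurent_cong: "laurent f \<Longrightarrow> (\<And>x. x \<in> C \<Longrightarrow> f x = g x) \<Longrightarrow> laurent g"
  unfolding laurent_def by simp

lemma laurent_local: "f \<in> local_ring \<Longrightarrow> laurent f"
  by (rule laurentI[of _ 0]) simp_all

lemma local_ring_power: "f \<in> local_ring \<Longrightarrow> (\<lambda>x. f x ^ n) \<in> local_ring"
  by (induction n) (simp_all add: local_ring.lconst local_ring.lmult)

lemma laurent_add:
  assumes "laurent f" "laurent g"
  shows "laurent (\<lambda>x. f x + g x)"
proof -
  obtain k l f' g' where *: "f' \<in> local_ring" "g' \<in> local_ring"
      "\<forall>x\<in>C. q x ^ k * f x = f' x" "\<forall>x\<in>C. q x ^ l * g x = g' x"
    using assms unfolding laurent_def by blast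
  have "Q ^ (k + l) * (s + t) = Q ^ l * (Q ^ k * s) + Q ^ k * (Q ^ l * t)" for Q s t :: complex
    by (simp add: power_add algebra_simps)
  then have eq: "q x ^ (k + l) * (f x + g x) = q x ^ l * f' x + q x ^ k * g' x" if "x \<in> C" for x
    using *(3,4) that by (simp only:)
  have "(\<lambda>x. q x ^ l * f' x + q x ^ k * g' x) \<in> local_ring"
    by (intro local_ring.ladd local_ring.lmult local_ring_power local_ring.lq *)
  then show ?thesis
    using eq by (rule laurentI)
qed

lemma laurent_mult:
  assumes "laurent f" "laurent g"
  shows "laurent (\<lambda>x. f x * g x)"
proof -
  obtain k l f' g' where *: "f' \<in> local_ring" "g' \<in> local_ring"
      "\<forall>x\<in>C. q x ^ k * f x = f' x" "\<forall>x\<in>C. q x ^ l * g x = g' x"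
    using assms unfolding laurent_def by blast
  have "Q ^ (k + l) * (s * t) = (Q ^ k * s) * (Q ^ l * t)" for Q s t :: complex
    by (simp add: power_add)
  then have "q x ^ (k + l) * (f x * g x) = f' x * g' x" if "x \<in> C" for x
    using *(3,4) that by (simp only:)
  then show ?thesis
    by (rule laurentI[OF local_ring.lmult[OF *(1,2)]])
qed

lemma laurent_const: "laurent (\<lambda>_. c)"
  by (intro laurent_local local_ring.lconst)

text \<open>Every quotient factors as \<open>(f / r1) * (r1 / g)\<close>. Poles at the center come
  only from \<open>b1 / r1\<close>, which is the inverse of \<open>q\<close>.\<close>

lemma laurent_quotient:
  assumes "f \<in> {r1, r2, b1, b2}" "g \<in> {r1, r2, b1, b2}"
  shows "laurent (\<lambda>x. f x / g x)"
proof -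
  have nz: "r1 x \<noteq> 0" "r2 x \<noteq> 0" "b1 x \<noteq> 0" "b2 x \<noteq> 0" if "x \<in> C" for x
    using unit that by auto
  have 1: "laurent (\<lambda>x. b1 x / r1 x)"
    by (rule laurentI[of "\<lambda>_. 1" 1]) (simp_all add: local_ring.lconst nz)
  have 2: "laurent (\<lambda>x. b2 x / r1 x)"
    by (rule laurent_cong[OF laurent_mult[OF laurent_local[OF local_ring.lb21] 1]]) (simp add: nz)
  have 3: "laurent (\<lambda>x. r1 x / b2 x)"
    by (rule laurent_cong[OF laurent_mult[OF laurent_local[OF local_ring.lq]
            laurent_local[OF local_ring.lb12]]]) (simp add: nz)
  have 4: "laurent (\<lambda>x. r1 x / r1 x)"
    by (rule laurent_cong[OF laurent_const[of 1]]) (simp add: nz)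
  have "laurent (\<lambda>x. f x / r1 x)" "laurent (\<lambda>x. r1 x / g x)"
    using assms 1 2 3 4 laurent_local[OF local_ring.lr21] laurent_local[OF local_ring.lr12]
      laurent_local[OF local_ring.lq] by auto
  from laurent_mult[OF this] show ?thesis
    by (rule laurent_cong) (simp add: nz)
qed

text \<open>The fixed edge \<open>f0\<close> is constant on \<open>C\<close>. Hence each edge
  function is a constant times a quotient of edge functions, and so is its inverse.\<close>

lemma laurent_edges:
  assumes "f0 \<in> {r1, r2, b1, b2}" "\<And>x. x \<in> C \<Longrightarrow> f0 x = a" "f \<in> {r1, r2, b1, b2}"
  shows "laurent f" "laurent (\<lambda>x. inverse (f x))"
proof -
  have nz: "f0 x \<noteq> 0" if "x \<in> C" for x
    using unit[OF assms(1) that] .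
  show "laurent f"
    by (rule laurent_cong[OF laurent_mult[OF laurent_const[of a] laurent_quotient[OF assms(3,1)]]])
      (use nz assms(2) in auto)
  show "laurent (\<lambda>x. inverse (f x))"
    by (rule laurent_cong[OF laurent_mult[OF laurent_const[of "inverse a"]
            laurent_quotient[OF assms(1,3)]]])
      (use nz assms(2) in \<open>auto simp: divide_inverse\<close>)
qed

end

locale separating_valuation =
  quadrilateral C K r1 r2 b1 b2 lr1 lr2 lb1 lb2 + fun_valuation C K w
  for C :: "'a set" and K r1 r2 b1 b2 lr1 lr2 lb1 lb2 w +
  assumes separates: "w b1 < w r1" "w b1 < w r2" "w b2 < w r1" "w b2 < w r2"
begin

lemma val_inverse_unit: "f \<in> {r1, r2, b1, b2} \<Longrightarrow> w (\<lambda>x. inverse (f x)) = - w f"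
  by (rule val_inverse[of f _ 1]) (simp_all add: edge_closed inverse_closed unit)

lemma nz_inverse: "f \<in> {r1, r2, b1, b2} \<Longrightarrow> nz (\<lambda>x. inverse (f x))"
  using unit nonempty by (auto simp: nz_def)

lemma val_blue: "w b1 = w b2"
proof -
  have False if "w b1 < w b2"
    by (rule val_sum_zero_not_less[of b1 b2 r1 r2])
      (use that separates edge_closed nz_unit sum_zero in \<open>simp_all add: ac_simps\<close>)
  moreover have False if "w b2 < w b1"
    by (rule val_sum_zero_not_less[of b2 b1 r1 r2])
      (use that separates edge_closed nz_unit sum_zero in \<open>simp_all add: ac_simps\<close>)
  ultimately show ?thesis
    using less_linear by blast
qed

text \<open>Inversion reverses the order of the values, so in the second equation the red terms have
  the smaller values, and neither of them can be the strict minimum.\<close>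

lemma val_red: "w r1 = w r2"
proof -
  have sc: "(\<lambda>x. c * inverse (f x)) \<in> K" "nz (\<lambda>x. c * inverse (f x))"
      "w (\<lambda>x. c * inverse (f x)) = - w f"
    if "f \<in> {r1, r2, b1, b2}" "c \<noteq> 0" for c f
    using inverse_closed[OF that(1)] nz_inverse[OF that(1)] val_inverse_unit[OF that(1)] that(2)
    by (simp_all add: val_scale nz_mult const_closed mult_closed)
  note sc1 = sc[of r1 lr1] sc[of r2 lr2] sc[of b1 lb1] sc[of b2 lb2]
  have inv: "lr1 * inverse (r1 x) + lr2 * inverse (r2 x) + lb1 * inverse (b1 x)
      + lb2 * inverse (b2 x) = 0" if "x \<in> C" for x
    using inverse_sum_zero[OF that] by (simp add: divide_inverse)
  have False if "w r1 < w r2"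
    by (rule val_sum_zero_not_less[of "\<lambda>x. lr2 * inverse (r2 x)" "\<lambda>x. lr1 * inverse (r1 x)"
        "\<lambda>x. lb1 * inverse (b1 x)" "\<lambda>x. lb2 * inverse (b2 x)"])
      (use that separates inv coeff_nonzero sc1 in \<open>simp_all add: ac_simps\<close>)
  moreover have False if "w r2 < w r1"
    by (rule val_sum_zero_not_less[of "\<lambda>x. lr1 * inverse (r1 x)" "\<lambda>x. lr2 * inverse (r2 x)"
        "\<lambda>x. lb1 * inverse (b1 x)" "\<lambda>x. lb2 * inverse (b2 x)"])
      (use that separates inv coeff_nonzero sc1 in \<open>simp_all add: ac_simps\<close>)
  ultimately show ?thesis
    using less_linear by blast
qed

lemma val_quotient:
  assumes "f \<in> {r1, r2, b1, b2}" "g \<in> {r1, r2, b1, b2}"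
  shows "w (\<lambda>x. f x / g x) = w f - w g"
  using val_mult[OF edge_closed[OF assms(1)] inverse_closed[OF assms(2)] nz_unit[OF assms(1)]
      nz_inverse[OF assms(2)]] val_inverse_unit[OF assms(2)]
  by (simp add: divide_inverse)

lemma val_q_pos: "0 < w q"
  using val_quotient[of r1 b1] separates by simp

text \<open>By \<open>val_red\<close> and \<open>val_blue\<close> all generators have value 0,
  except \<open>q\<close>, whose value is positive, and possible zero constants.\<close>

lemma local_ring_nonneg: "f \<in> local_ring \<Longrightarrow> nz f \<Longrightarrow> 0 \<le> w f"
proof (induction rule: local_ring.induct)
  case (ladd f g)
  have "\<not> w (\<lambda>x. f x + g x) < 0"
  proof
    assume "w (\<lambda>x. f x + g x) < 0"
    then have "w (\<lambda>x. f x + g x) < w (\<lambda>x. f x + g x)"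
      using ladd by (intro val_add_greater) (auto intro: local_ring_subset)
    then show False
      by simp
  qed
  then show ?case
    by simp
next
  case (lmult f g)
  then have "nz f" "nz g"
    by (simp_all add: nz_mult local_ring_subset)
  then show ?case
    using lmult by (simp add: val_mult local_ring_subset)
qed (use val_blue val_red val_q_pos in \<open>simp_all add: val_quotient val_const\<close>)

lemma val_unit_at:
  assumes "h \<in> local_ring" "c \<noteq> 0"
  shows "nz (\<lambda>x. c + q x * h x)" "w (\<lambda>x. c + q x * h x) = 0"
proof -
  have "0 < w (\<lambda>x. q x * h x)" if "nz (\<lambda>x. q x * h x)"
  proof -
    have "nz h"
      using that assms nz_mult[OF q_closed local_ring_subset] by blast
    then show ?thesis
      using val_mult[OF q_closed local_ring_subset nz_q] local_ring_nonneg val_q_pos assms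
      by fastforce
  qed
  then show "nz (\<lambda>x. c + q x * h x)" "w (\<lambda>x. c + q x * h x) = 0"
    using val_const_add[of "\<lambda>x. q x * h x" c] assms mult_closed[OF q_closed local_ring_subset]
    by blast+
qed

text \<open>The factor \<open>c + q * h\<close> has value 0, so comparing the values of both sides
  leaves only multiples of \<open>w q\<close>.\<close>

lemma val_eq_order:
  assumes "f \<in> K" "nz f" "order_at f n"
  shows "w f = of_int n * w q"
proof -
  obtain k m c h where *: "h \<in> local_ring" "n = int m - int k" "c \<noteq> 0"
      "\<forall>x\<in>C. q x ^ k * f x = q x ^ m * (c + q x * h x)"
    using assms(3) by (auto simp: order_at_def)
  have u: "(\<lambda>x. c + q x * h x) \<in> K"
    by (intro add_closed const_closed mult_closed q_closed local_ring_subset *)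
  have "w (\<lambda>x. q x ^ k * f x) = w (\<lambda>x. q x ^ m * (c + q x * h x))"
    using *(4) by (intro val_cong mult_closed power_closed q_closed assms) auto
  then have "of_nat k * w q + w f = of_nat m * w q"
    using val_mult[OF power_closed[OF q_closed] assms(1) nz_power[OF q_closed nz_q] assms(2)]
      val_mult[OF power_closed[OF q_closed] u nz_power[OF q_closed nz_q] val_unit_at(1)[OF *(1,3)]]
      val_power[OF q_closed nz_q] val_unit_at(2)[OF *(1,3)]
    by simp
  then show ?thesis
    by (simp add: *(2) algebra_simps)
qed

text \<open>The division by \<open>q\<close> terminates, as it lowers the value by \<open>w q > 0\<close> and the values of
  \<open>local_ring\<close> are nonnegative.\<close>

lemma local_ring_order:
  assumes "f \<in> local_ring" "nz f" "w f < of_nat N * w q"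
  shows "\<exists>m c. \<exists>h\<in>local_ring. c \<noteq> 0 \<and> (\<forall>x\<in>C. f x = q x ^ m * (c + q x * h x))"
  using assms
proof (induction N arbitrary: f)
  case 0
  then show ?case
    using local_ring_nonneg[OF 0(1,2)] by simp
next
  case (Suc N)
  obtain c h where ch: "h \<in> local_ring" "\<forall>x\<in>C. f x = c + q x * h x"
    using local_ring_decomp[OF Suc.prems(1)] by blast
  show ?case
  proof (cases "c = 0")
    case True
    then have f: "f x = q x * h x" if "x \<in> C" for x
      using ch(2) that by simp
    then have "nz (\<lambda>x. q x * h x)"
      using Suc.prems(2) nz_cong[of f "\<lambda>x. q x * h x"] by simp
    then have h: "nz h"
      using nz_mult[OF q_closed local_ring_subset[OF ch(1)]] by simp
    have "w f = w (\<lambda>x. q x * h x)"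
      using f Suc.prems(1) by (intro val_cong local_ring_subset) auto
    then have "w f = w q + w h"
      using val_mult[OF q_closed local_ring_subset[OF ch(1)] nz_q h] by simp
    then have "w h < of_nat N * w q"
      using Suc.prems(3) by (simp add: distrib_right)
    from Suc.IH[OF ch(1) h this]
    obtain m d k where k: "k \<in> local_ring" "d \<noteq> 0" "\<forall>x\<in>C. h x = q x ^ m * (d + q x * k x)"
      by blast
    have "\<forall>x\<in>C. f x = q x ^ Suc m * (d + q x * k x)"
      using f k(3) by (simp only: power_Suc mult.assoc) blast
    with k(1,2) show ?thesis
      by (intro exI[of _ "Suc m"] exI[of _ d] bexI[of _ k] conjI)
  next
    case False
    then show ?thesis
      using ch by (intro exI[of _ 0] exI[of _ c] bexI[of _ h]) simp_all
  qed
qed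

lemma order_exists:
  assumes "f \<in> K" "nz f" "g \<in> local_ring" "\<forall>x\<in>C. q x ^ k * f x = g x"
  shows "\<exists>n. order_at f n"
proof -
  have "nz (\<lambda>x. q x ^ k * f x)"
    using nz_mult[OF power_closed[OF q_closed] assms(1)] nz_power[OF q_closed nz_q] assms(2)
    by blast
  then have "nz g"
    using assms(4) nz_cong[of "\<lambda>x. q x ^ k * f x" g] by simp
  \<comment> \<open>The rationals are Archimedean: some multiple of \<open>w q\<close> exceeds
    \<open>w g\<close>, and this bounds the number of divisions by \<open>q\<close>.\<close>
  obtain N where "w g / w q < of_nat N"
    using reals_Archimedean2 by blast
  then have "w g < of_nat N * w q"
    using val_q_pos by (simp add: pos_divide_less_eq)
  then obtain m c h where h: "h \<in> local_ring" "c \<noteq> 0" "\<forall>x\<in>C. g x = q x ^ m * (c + q x * h x)"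
    using local_ring_order[OF assms(3) \<open>nz g\<close>] by blast
  have "\<forall>x\<in>C. q x ^ k * f x = q x ^ m * (c + q x * h x)"
    using assms(4) h(3) by simp
  with h(1,2) show ?thesis
    unfolding order_at_def
    by (intro exI[of _ "int m - int k"] exI[of _ k] exI[of _ m] exI[of _ c] bexI[of _ h] conjI refl)
qed

end

section \<open>Valuations of function fields\<close>

definition regular :: "'v set \<Rightarrow> 'v point set \<Rightarrow> ('v point \<Rightarrow> complex) set" where
  "regular V C = {f. restrict f C \<in> carrier (coordinate_ring V C)}"

lemma regular_iff: "f \<in> regular V C \<longleftrightarrow> (\<exists>p\<in>polys V. \<forall>\<rho>\<in>C. f \<rho> = p \<rho>)"
  by (auto simp: regular_def coordinate_ring_simps restrict_eq_iff)

lemma polys_subset_regular: "polys V \<subseteq> regular V C"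
  by (auto simp: regular_iff)

lemma function_ring_regular:
  assumes "irreducible_set V C"
  shows "function_ring C (regular V C)"
proof
  show "C \<noteq> {}"
    using assms by (simp add: irreducible_set_def)
next
  fix f g assume "f \<in> regular V C" "g \<in> regular V C"
  then obtain p r where pr: "p \<in> polys V" "r \<in> polys V" "\<forall>\<rho>\<in>C. f \<rho> = p \<rho>" "\<forall>\<rho>\<in>C. g \<rho> = r \<rho>"
    unfolding regular_iff by blast
  show "(\<lambda>x. f x + g x) \<in> regular V C" "(\<lambda>x. f x * g x) \<in> regular V C"
    unfolding regular_iff using pr polys.add[OF pr(1,2)] polys.mult[OF pr(1,2)] by force+
  show "\<exists>x\<in>C. f x * g x \<noteq> 0" if "\<exists>x\<in>C. f x \<noteq> 0" "\<exists>x\<in>C. g x \<noteq> 0"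
    using irreducible_set_integral[OF assms pr(1,2)] pr(3,4) that by auto
qed (auto simp: regular_iff intro: polys.const)

lemma restrict_nonzero_iff:
  "restrict f C \<in> carrier (coordinate_ring V C) - {\<zero>\<^bsub>coordinate_ring V C\<^esub>} \<longleftrightarrow>
    f \<in> regular V C \<and> (\<exists>\<rho>\<in>C. f \<rho> \<noteq> 0)"
  by (auto simp: regular_def coordinate_ring_simps(3) restrict_eq_iff)

lemma of_poly_mult:
  assumes "irreducible_set V C" "f \<in> regular V C" "g \<in> regular V C"
  shows "of_poly V C f \<otimes>\<^bsub>function_field V C\<^esub> of_poly V C g = of_poly V C (\<lambda>\<rho>. f \<rho> * g \<rho>)"
proof -
  interpret R: domain "coordinate_ring V C"
    by (rule domain_coordinate_ring) fact
  have one: "restrict (\<lambda>_. 1) C = \<one>\<^bsub>coordinate_ring V C\<^esub>"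
    by (simp add: coordinate_ring_simps)
  show ?thesis
    using assms unfolding of_poly_def function_field_def one
    by (subst R.fraction_mult) (auto simp: regular_def coordinate_ring_simps(4))
qed

lemma of_poly_add:
  assumes "irreducible_set V C" "f \<in> regular V C" "g \<in> regular V C"
  shows "of_poly V C f \<oplus>\<^bsub>function_field V C\<^esub> of_poly V C g = of_poly V C (\<lambda>\<rho>. f \<rho> + g \<rho>)"
proof -
  interpret R: domain "coordinate_ring V C"
    by (rule domain_coordinate_ring) fact
  have one: "restrict (\<lambda>_. 1) C = \<one>\<^bsub>coordinate_ring V C\<^esub>"
    by (simp add: coordinate_ring_simps)
  show ?thesis
    using assms unfolding of_poly_def function_field_def one
    by (subst R.fraction_add) (auto simp: regular_def coordinate_ring_simps(5))
qed

lemma of_poly_nonzero: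
  assumes "irreducible_set V C" "f \<in> regular V C" "\<exists>\<rho>\<in>C. f \<rho> \<noteq> 0"
  shows "of_poly V C f \<in> carrier (function_field V C) - {\<zero>\<^bsub>function_field V C\<^esub>}"
proof -
  interpret R: domain "coordinate_ring V C"
    by (rule domain_coordinate_ring) fact
  have one: "restrict (\<lambda>_. 1) C = \<one>\<^bsub>coordinate_ring V C\<^esub>"
    by (simp add: coordinate_ring_simps)
  show ?thesis
    using assms(2,3) restrict_nonzero_iff[of f C V] unfolding of_poly_def function_field_def one
    by (intro R.fraction_nonzero) auto
qed

lemma of_poly_cong: "(\<And>\<rho>. \<rho> \<in> C \<Longrightarrow> f \<rho> = g \<rho>) \<Longrightarrow> of_poly V C f = of_poly V C g"
  unfolding of_poly_def by (metis restrict_ext)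

lemma valuation_mult:
  assumes "valuation F \<nu>" "a \<in> carrier F - {\<zero>\<^bsub>F\<^esub>}" "b \<in> carrier F - {\<zero>\<^bsub>F\<^esub>}"
  shows "\<nu> (a \<otimes>\<^bsub>F\<^esub> b) = \<nu> a + \<nu> b"
  using assms unfolding valuation_def by blast

lemma valuation_add:
  assumes "valuation F \<nu>" "a \<in> carrier F - {\<zero>\<^bsub>F\<^esub>}" "b \<in> carrier F - {\<zero>\<^bsub>F\<^esub>}"
    and "a \<oplus>\<^bsub>F\<^esub> b \<noteq> \<zero>\<^bsub>F\<^esub>"
  shows "min (\<nu> a) (\<nu> b) \<le> \<nu> (a \<oplus>\<^bsub>F\<^esub> b)"
  using assms unfolding valuation_def by blast

text \<open>The quantifier over valuations stands behind the choice of \<open>f\<close> and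
  \<open>g\<close>, so that two valuations can be compared on the same numerator and
  denominator.\<close>

lemma function_field_nonzero_cases:
  assumes "irreducible_set V C" "X \<in> carrier (function_field V C) - {\<zero>\<^bsub>function_field V C\<^esub>}"
  obtains f g where "f \<in> regular V C" "\<exists>\<rho>\<in>C. f \<rho> \<noteq> 0" "g \<in> regular V C" "\<exists>\<rho>\<in>C. g \<rho> \<noteq> 0"
    "\<forall>\<nu> :: _ \<Rightarrow> 'g::linordered_ab_group_add.
       valuation (function_field V C) \<nu> \<longrightarrow> \<nu> X = \<nu> (of_poly V C f) - \<nu> (of_poly V C g)"
proof -
  interpret R: domain "coordinate_ring V C"
    by (rule domain_coordinate_ring) fact
  obtain a b where ab: "a \<in> carrier (coordinate_ring V C) - {\<zero>\<^bsub>coordinate_ring V C\<^esub>}"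
      "b \<in> carrier (coordinate_ring V C) - {\<zero>\<^bsub>coordinate_ring V C\<^esub>}"
      "X = fraction (coordinate_ring V C) a b"
    by (rule R.nonzero_fraction_cases[OF assms(2)[unfolded function_field_def]])
  then obtain f g where fg: "a = restrict f C" "b = restrict g C"
    by (auto simp: coordinate_ring_simps)
  show ?thesis
  proof
    show "f \<in> regular V C" "\<exists>\<rho>\<in>C. f \<rho> \<noteq> 0" "g \<in> regular V C" "\<exists>\<rho>\<in>C. g \<rho> \<noteq> 0"
      using ab(1,2)[unfolded fg restrict_nonzero_iff] by blast+
    show "\<forall>\<nu> :: _ \<Rightarrow> 'g. valuation (function_field V C) \<nu> \<longrightarrow>
        \<nu> X = \<nu> (of_poly V C f) - \<nu> (of_poly V C g)"
    proof (intro allI impI)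
      fix \<nu> :: "_ \<Rightarrow> 'g"
      assume "valuation (function_field V C) \<nu>"
      from R.valuation_fraction[OF this[unfolded function_field_def] ab(1,2)]
      show "\<nu> X = \<nu> (of_poly V C f) - \<nu> (of_poly V C g)"
        by (simp add: ab(3) fg of_poly_def coordinate_ring_simps(2))
    qed
  qed
qed

text \<open>The map \<open>\<phi>\<close> embeds the value group into the rationals: it is the
  identity for rational valuations and \<open>of_int\<close> for integral ones.\<close>

lemma fun_valuation_of_poly:
  fixes \<nu> :: "_ \<Rightarrow> 'g::linordered_ab_group_add" and \<phi> :: "'g \<Rightarrow> rat"
  assumes "irreducible_set V C" "valuation (function_field V C) \<nu>" "trivial_on_constants V C \<nu>"
    and "mono \<phi>" "\<phi> 0 = 0" "\<And>a b. \<phi> (a + b) = \<phi> a + \<phi> b"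
  shows "fun_valuation C (regular V C) (\<lambda>f. \<phi> (\<nu> (of_poly V C f)))"
proof -
  interpret function_ring C "regular V C"
    by (rule function_ring_regular) fact
  show ?thesis
  proof
    fix f g assume fg: "f \<in> regular V C" "g \<in> regular V C" "nz f" "nz g"
    note nz = of_poly_nonzero[OF assms(1) fg(1) fg(3)[unfolded nz_def]]
      of_poly_nonzero[OF assms(1) fg(2) fg(4)[unfolded nz_def]]
    show "\<phi> (\<nu> (of_poly V C (\<lambda>x. f x * g x))) = \<phi> (\<nu> (of_poly V C f)) + \<phi> (\<nu> (of_poly V C g))"
      using valuation_mult[OF assms(2) nz] by (simp add: assms(6) of_poly_mult[OF assms(1) fg(1,2)])
    assume "nz (\<lambda>x. f x + g x)"
    then have "of_poly V C f \<oplus>\<^bsub>function_field V C\<^esub> of_poly V C g \<noteq> \<zero>\<^bsub>function_field V C\<^esub>"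
      using of_poly_nonzero[OF assms(1) add_closed[OF fg(1,2)]] of_poly_add[OF assms(1) fg(1,2)]
      by (simp add: nz_def)
    then have "min (\<nu> (of_poly V C f)) (\<nu> (of_poly V C g)) \<le> \<nu> (of_poly V C (\<lambda>x. f x + g x))"
      using valuation_add[OF assms(2) nz] by (simp only: of_poly_add[OF assms(1) fg(1,2)] simp_thms)
    then show "min (\<phi> (\<nu> (of_poly V C f))) (\<phi> (\<nu> (of_poly V C g)))
        \<le> \<phi> (\<nu> (of_poly V C (\<lambda>x. f x + g x)))"
      using monoD[OF assms(4)] by (simp only: min_of_mono[OF assms(4)])
  next
    show "\<phi> (\<nu> (of_poly V C (\<lambda>_. c))) = 0" if "c \<noteq> 0" for c
      using assms(3,5) that by (simp add: trivial_on_constants_def)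
  next
    show "\<phi> (\<nu> (of_poly V C f)) = \<phi> (\<nu> (of_poly V C g))" if "\<And>x. x \<in> C \<Longrightarrow> f x = g x" for f g
      using of_poly_cong[of C f g] that by simp
  qed
qed

text \<open>All values are integer multiples of \<open>g\<close>, so the quotients are integers
  already and \<open>floor\<close> merely changes their type.\<close>

lemma valuation_rescale:
  fixes \<nu> :: "_ \<Rightarrow> rat"
  assumes "irreducible_set V C" "valuation (function_field V C) \<nu>" "0 < g"
    and int: "\<And>X. X \<in> carrier (function_field V C) - {\<zero>\<^bsub>function_field V C\<^esub>} \<Longrightarrow>
      \<exists>n. \<nu> X = of_int n * g"
  shows "valuation (function_field V C)
    (\<lambda>X\<in>carrier (function_field V C) - {\<zero>\<^bsub>function_field V C\<^esub>}. \<lfloor>\<nu> X / g\<rfloor>)"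
    (is "valuation ?F ?\<mu>")
  unfolding valuation_def
proof (intro conjI ballI impI)
  interpret R: domain "coordinate_ring V C"
    by (rule domain_coordinate_ring) fact
  fix X Y assume XY: "X \<in> carrier ?F - {\<zero>\<^bsub>?F\<^esub>}" "Y \<in> carrier ?F - {\<zero>\<^bsub>?F\<^esub>}"
  obtain m n where mn: "\<nu> X = of_int m * g" "\<nu> Y = of_int n * g"
    using int XY by blast
  have "X \<otimes>\<^bsub>?F\<^esub> Y \<in> carrier ?F - {\<zero>\<^bsub>?F\<^esub>}"
    using R.fraction_field_mult_nonzero XY unfolding function_field_def by blast
  moreover have "\<nu> (X \<otimes>\<^bsub>?F\<^esub> Y) = \<nu> X + \<nu> Y"
    by (rule valuation_mult[OF assms(2) XY])
  moreover have "(of_int m * g + of_int n * g) / g = of_int (m + n)"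
    using assms(3) by (simp add: field_simps)
  ultimately show "?\<mu> (X \<otimes>\<^bsub>?F\<^esub> Y) = ?\<mu> X + ?\<mu> Y"
    using XY mn assms(3) by (simp del: of_int_add)
  assume nz: "X \<oplus>\<^bsub>?F\<^esub> Y \<noteq> \<zero>\<^bsub>?F\<^esub>"
  then have "X \<oplus>\<^bsub>?F\<^esub> Y \<in> carrier ?F - {\<zero>\<^bsub>?F\<^esub>}"
    using R.fraction_field_add_closed XY unfolding function_field_def by blast
  moreover from this obtain k where k: "\<nu> (X \<oplus>\<^bsub>?F\<^esub> Y) = of_int k * g"
    using int by blast
  moreover have "min (\<nu> X) (\<nu> Y) \<le> \<nu> (X \<oplus>\<^bsub>?F\<^esub> Y)"
    by (rule valuation_add[OF assms(2) XY nz])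
  then have "min m n \<le> k"
    using assms(3) by (simp add: mn k min_le_iff_disj)
  ultimately show "min (?\<mu> X) (?\<mu> Y) \<le> ?\<mu> (X \<oplus>\<^bsub>?F\<^esub> Y)"
    using XY mn assms(3) by simp
qed simp

text \<open>By \<open>regular_laurent\<close> every regular function lies in
  \<open>local_ring\<close> after multiplication by a power of \<open>q\<close>. Orders with respect
  to \<open>q\<close> therefore control a separating valuation on the whole function field, not only
  on quotients of edge functions.\<close>

locale coupled_motion =
  quadrilateral C "regular V C" r1 r2 b1 b2 lr1 lr2 lb1 lb2
  for V :: "'v set" and C r1 r2 b1 b2 lr1 lr2 lb1 lb2 +
  assumes irreducible: "irreducible_set V C"
    and regular_laurent: "f \<in> regular V C \<Longrightarrow> laurent f"
begin

text \<open>This is positivity of the gap. The value type is left open because the notion is applied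
  to rational valuations as well as to those in \<open>Val\<close>.\<close>

definition separates :: "((('v point \<Rightarrow> complex) \<times> ('v point \<Rightarrow> complex)) set \<Rightarrow> 'g::linorder) \<Rightarrow> bool"
  where
  "separates \<nu> \<longleftrightarrow> (\<forall>r\<in>{r1, r2}. \<forall>b\<in>{b1, b2}. \<nu> (of_poly V C b) < \<nu> (of_poly V C r))"

lemma separating_valuation_of_poly:
  fixes \<nu> :: "_ \<Rightarrow> 'g::linordered_ab_group_add" and \<phi> :: "'g \<Rightarrow> rat"
  assumes "valuation (function_field V C) \<nu>" "trivial_on_constants V C \<nu>" "separates \<nu>"
    and "strict_mono \<phi>" "\<phi> 0 = 0" "\<And>a b. \<phi> (a + b) = \<phi> a + \<phi> b"
  shows "separating_valuation C (regular V C) r1 r2 b1 b2 lr1 lr2 lb1 lb2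
    (\<lambda>f. \<phi> (\<nu> (of_poly V C f)))"
proof -
  interpret fun_valuation C "regular V C" "\<lambda>f. \<phi> (\<nu> (of_poly V C f))"
    by (rule fun_valuation_of_poly[OF irreducible assms(1,2) strict_mono_mono[OF assms(4)] assms(5,6)])
  show ?thesis
    using assms(3) strict_monoD[OF assms(4)] by unfold_locales (auto simp: separates_def)
qed

lemma separating_valuation_rat:
  fixes \<nu> :: "_ \<Rightarrow> rat"
  assumes "valuation (function_field V C) \<nu>" "trivial_on_constants V C \<nu>" "separates \<nu>"
  shows "separating_valuation C (regular V C) r1 r2 b1 b2 lr1 lr2 lb1 lb2 (\<lambda>f. \<nu> (of_poly V C f))"
  by (rule separating_valuation_of_poly[OF assms, of "\<lambda>x. x"]) (simp_all add: strict_mono_def)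

lemma separating_valuation_int:
  assumes "\<nu> \<in> Val V C" "separates \<nu>"
  shows "separating_valuation C (regular V C) r1 r2 b1 b2 lr1 lr2 lb1 lb2
    (\<lambda>f. of_int (\<nu> (of_poly V C f)))"
  by (rule separating_valuation_of_poly[of \<nu>]) (use assms in \<open>simp_all add: Val_def strict_mono_def\<close>)

text \<open>A separating valuation makes the division by \<open>q\<close> terminate, but the order
  found in this way does not refer to it and can be used with any other one.\<close>

lemma order_at_exists:
  assumes "separating_valuation C (regular V C) r1 r2 b1 b2 lr1 lr2 lb1 lb2 w"
    and "f \<in> regular V C" "\<exists>\<rho>\<in>C. f \<rho> \<noteq> 0"
  shows "\<exists>n. order_at f n"
proof -
  interpret separating_valuation C "regular V C" r1 r2 b1 b2 lr1 lr2 lb1 lb2 w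
    by fact
  obtain k g where "g \<in> local_ring" "\<forall>x\<in>C. q x ^ k * f x = g x"
    using regular_laurent[OF assms(2)] unfolding laurent_def by blast
  then show ?thesis
    by (rule order_exists[OF assms(2) assms(3)[folded nz_def]])
qed

lemma Val_eq_order:
  assumes "\<nu> \<in> Val V C" "separates \<nu>" "f \<in> regular V C" "\<exists>\<rho>\<in>C. f \<rho> \<noteq> 0" "order_at f n"
  shows "\<nu> (of_poly V C f) = n * \<nu> (of_poly V C q)"
proof -
  interpret separating_valuation C "regular V C" r1 r2 b1 b2 lr1 lr2 lb1 lb2
    "\<lambda>f. of_int (\<nu> (of_poly V C f))"
    using assms(1,2) by (rule separating_valuation_int)
  have "rat_of_int (\<nu> (of_poly V C f)) = of_int n * of_int (\<nu> (of_poly V C q))"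
    using assms(3-5) by (intro val_eq_order) (auto simp: nz_def)
  then show ?thesis
    by (simp only: of_int_mult[symmetric] of_int_eq_iff)
qed

text \<open>Surjectivity gives an element of value 1. Its numerator and denominator have orders
  \<open>m\<close> and \<open>n\<close>, hence \<open>(m - n) * \<nu> q = 1\<close> with a positive
  integer \<open>\<nu> q\<close>.\<close>

lemma Val_uniformizer:
  assumes "\<nu> \<in> Val V C" "separates \<nu>"
  shows "\<nu> (of_poly V C q) = 1"
proof -
  have sep: "separating_valuation C (regular V C) r1 r2 b1 b2 lr1 lr2 lb1 lb2
      (\<lambda>f. of_int (\<nu> (of_poly V C f)))"
    using assms by (rule separating_valuation_int)
  then interpret separating_valuation C "regular V C" r1 r2 b1 b2 lr1 lr2 lb1 lb2
    "\<lambda>f. of_int (\<nu> (of_poly V C f))" .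
  have surj: "\<nu> ` (carrier (function_field V C) - {\<zero>\<^bsub>function_field V C\<^esub>}) = UNIV"
    using assms(1) by (simp add: Val_def)
  have "1 \<in> \<nu> ` (carrier (function_field V C) - {\<zero>\<^bsub>function_field V C\<^esub>})"
    unfolding surj by (rule UNIV_I)
  then obtain X where X: "X \<in> carrier (function_field V C) - {\<zero>\<^bsub>function_field V C\<^esub>}" "1 = \<nu> X"
    by (elim imageE)
  have val: "valuation (function_field V C) \<nu>"
    using assms(1) by (simp add: Val_def)
  obtain f g where fg: "f \<in> regular V C" "\<exists>\<rho>\<in>C. f \<rho> \<noteq> 0" "g \<in> regular V C" "\<exists>\<rho>\<in>C. g \<rho> \<noteq> 0"
    "\<forall>\<nu> :: _ \<Rightarrow> int. valuation (function_field V C) \<nu> \<longrightarrow>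
      \<nu> X = \<nu> (of_poly V C f) - \<nu> (of_poly V C g)"
    by (rule function_field_nonzero_cases[where 'g = int, OF irreducible X(1)])
  obtain m n where mn: "order_at f m" "order_at g n"
    using order_at_exists[OF sep fg(1,2)] order_at_exists[OF sep fg(3,4)] by blast
  have "1 = m * \<nu> (of_poly V C q) - n * \<nu> (of_poly V C q)"
    by (rule X(2)[unfolded fg(5)[rule_format, OF val]
        Val_eq_order[OF assms fg(1,2) mn(1)] Val_eq_order[OF assms fg(3,4) mn(2)]])
  then have "\<nu> (of_poly V C q) * (m - n) = 1"
    by (simp add: algebra_simps)
  moreover have "0 < \<nu> (of_poly V C q)"
    using val_q_pos by simp
  ultimately show ?thesis
    using pos_zmult_eq_1_iff[of "\<nu> (of_poly V C q)" "m - n"] by simp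
qed

lemma Val_edges:
  assumes "\<nu> \<in> Val V C" "separates \<nu>"
  shows "\<nu> (of_poly V C r1) = \<nu> (of_poly V C r2)" "\<nu> (of_poly V C b1) = \<nu> (of_poly V C b2)"
    "\<nu> (of_poly V C r1) - \<nu> (of_poly V C b1) = 1"
proof -
  interpret separating_valuation C "regular V C" r1 r2 b1 b2 lr1 lr2 lb1 lb2
    "\<lambda>f. of_int (\<nu> (of_poly V C f))"
    using assms by (rule separating_valuation_int)
  show "\<nu> (of_poly V C r1) = \<nu> (of_poly V C r2)" "\<nu> (of_poly V C b1) = \<nu> (of_poly V C b2)"
    using val_red val_blue by simp_all
  have "rat_of_int (\<nu> (of_poly V C q)) = of_int (\<nu> (of_poly V C r1) - \<nu> (of_poly V C b1))"
    using val_quotient[of r1 b1] by simp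
  then show "\<nu> (of_poly V C r1) - \<nu> (of_poly V C b1) = 1"
    by (simp only: of_int_eq_iff Val_uniformizer[OF assms])
qed

text \<open>Both valuations are 1 on \<open>q\<close> and multiply the same orders of numerator and
  denominator by this value. Off the nonzero elements they agree by extensionality.\<close>

lemma Val_unique:
  assumes "\<nu> \<in> Val V C" "separates \<nu>" "\<mu> \<in> Val V C" "separates \<mu>"
  shows "\<nu> = \<mu>"
proof (rule extensionalityI)
  show "\<nu> \<in> extensional (carrier (function_field V C) - {\<zero>\<^bsub>function_field V C\<^esub>})"
    "\<mu> \<in> extensional (carrier (function_field V C) - {\<zero>\<^bsub>function_field V C\<^esub>})"
    using assms(1,3) by (simp_all add: Val_def valuation_def)
  fix X assume X: "X \<in> carrier (function_field V C) - {\<zero>\<^bsub>function_field V C\<^esub>}"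
  have val: "valuation (function_field V C) \<nu>" "valuation (function_field V C) \<mu>"
    using assms(1,3) by (simp_all add: Val_def)
  obtain f g where fg: "f \<in> regular V C" "\<exists>\<rho>\<in>C. f \<rho> \<noteq> 0" "g \<in> regular V C" "\<exists>\<rho>\<in>C. g \<rho> \<noteq> 0"
    "\<forall>\<nu> :: _ \<Rightarrow> int. valuation (function_field V C) \<nu> \<longrightarrow>
      \<nu> X = \<nu> (of_poly V C f) - \<nu> (of_poly V C g)"
    by (rule function_field_nonzero_cases[where 'g = int, OF irreducible X])
  note sep = separating_valuation_int[OF assms(1,2)]
  obtain m n where mn: "order_at f m" "order_at g n"
    using order_at_exists[OF sep fg(1,2)] order_at_exists[OF sep fg(3,4)] by blast
  show "\<nu> X = \<mu> X"
    by (simp only: fg(5)[rule_format, OF val(1)] fg(5)[rule_format, OF val(2)]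
        Val_eq_order[OF assms(1,2) fg(1,2) mn(1)] Val_eq_order[OF assms(1,2) fg(3,4) mn(2)]
        Val_eq_order[OF assms(3,4) fg(1,2) mn(1)] Val_eq_order[OF assms(3,4) fg(3,4) mn(2)]
        Val_uniformizer[OF assms(1,2)] Val_uniformizer[OF assms(3,4)])
qed

text \<open>Dividing by the value of \<open>q\<close> turns the given valuation into an integral
  one, since all its values are integer multiples of that number. Surjectivity comes from the powers
  of \<open>q\<close> and of its inverse.\<close>

lemma Val_exists:
  fixes \<nu> :: "_ \<Rightarrow> rat"
  assumes "valuation (function_field V C) \<nu>" "trivial_on_constants V C \<nu>" "separates \<nu>"
  shows "\<exists>\<mu>\<in>Val V C. separates \<mu>"
proof -
  have sep: "separating_valuation C (regular V C) r1 r2 b1 b2 lr1 lr2 lb1 lb2 (\<lambda>f. \<nu> (of_poly V C f))"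
    using assms by (rule separating_valuation_rat)
  then interpret separating_valuation C "regular V C" r1 r2 b1 b2 lr1 lr2 lb1 lb2
    "\<lambda>f. \<nu> (of_poly V C f)" .
  define F where "F = carrier (function_field V C) - {\<zero>\<^bsub>function_field V C\<^esub>}"
  define g where "g = \<nu> (of_poly V C q)"
  have g: "0 < g"
    using val_q_pos by (simp add: g_def)
  define \<mu> where "\<mu> = (\<lambda>X\<in>F. \<lfloor>\<nu> X / g\<rfloor>)"
  have poly: "of_poly V C f \<in> F" if "f \<in> regular V C" "nz f" for f
    using of_poly_nonzero[OF irreducible that(1)] that(2) by (simp add: F_def nz_def)
  have poly_order: "\<exists>n. \<nu> (of_poly V C f) = of_int n * g" if "f \<in> regular V C" "nz f" for f
    using order_at_exists[OF sep that(1) that(2)[unfolded nz_def]] val_eq_order[OF that]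
    unfolding g_def by blast
  have int: "\<exists>n. \<nu> X = of_int n * g" if X: "X \<in> F" for X
  proof -
    obtain f h where fh: "f \<in> regular V C" "\<exists>\<rho>\<in>C. f \<rho> \<noteq> 0" "h \<in> regular V C" "\<exists>\<rho>\<in>C. h \<rho> \<noteq> 0"
      "\<forall>\<nu> :: _ \<Rightarrow> rat. valuation (function_field V C) \<nu> \<longrightarrow>
      \<nu> X = \<nu> (of_poly V C f) - \<nu> (of_poly V C h)"
      by (rule function_field_nonzero_cases[where 'g = rat, OF irreducible X[unfolded F_def]])
    obtain m n where "\<nu> (of_poly V C f) = of_int m * g" "\<nu> (of_poly V C h) = of_int n * g"
      using poly_order[OF fh(1)] poly_order[OF fh(3)] fh(2,4) unfolding nz_def by blast
    then have "\<nu> X = of_int (m - n) * g"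
      by (simp add: fh(5)[rule_format, OF assms(1)] left_diff_distrib)
    then show ?thesis ..
  qed
  have "valuation (function_field V C) \<mu>"
    unfolding \<mu>_def F_def
    using int by (intro valuation_rescale[OF irreducible assms(1) g]) (simp add: F_def)
  moreover have "trivial_on_constants V C \<mu>"
    using assms(2) poly[OF const_closed] unfolding trivial_on_constants_def by (simp add: \<mu>_def)
  moreover have "\<mu> ` F = UNIV"
  proof (intro equalityI subset_UNIV subsetI)
    fix n :: int
    have surj: "n \<in> \<mu> ` F" if "f \<in> regular V C" "nz f" "\<nu> (of_poly V C f) = of_int n * g" for f
      using poly[OF that(1,2)] that(3) g by (intro image_eqI[of _ _ "of_poly V C f"]) (simp_all add: \<mu>_def)
    have pw: "\<nu> (of_poly V C (\<lambda>x. f x ^ m)) = of_nat m * \<nu> (of_poly V C f)"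
      "(\<lambda>x. f x ^ m) \<in> regular V C" "nz (\<lambda>x. f x ^ m)"
      if "f \<in> regular V C" "nz f" for f m
      using val_power[OF that] power_closed[OF that(1)] nz_power[OF that] by blast+
    show "n \<in> \<mu> ` F"
    proof (cases "0 \<le> n")
      case True
      then have "rat_of_nat (nat n) = of_int n"
        by simp
      then show ?thesis
        using pw(1)[OF q_closed nz_q, of "nat n"] unfolding g_def[symmetric]
        by (intro surj[OF pw(2,3)[OF q_closed nz_q, of "nat n"]]) (simp only:)
    next
      case False
      \<comment> \<open>Negative integers are the values of powers of \<open>b1 / r1\<close>, the
        inverse of \<open>q\<close>.\<close>
      have inv: "(\<lambda>x. b1 x / r1 x) \<in> regular V C" "nz (\<lambda>x. b1 x / r1 x)"
        by (simp_all add: quotient_closed nz_quotient)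
      have "\<nu> (of_poly V C (\<lambda>x. b1 x / r1 x)) = - g"
        using val_quotient[of b1 r1] val_quotient[of r1 b1] by (simp add: g_def)
      moreover have "rat_of_nat (nat (- n)) * (- g) = of_int n * g"
        using False by simp
      ultimately show ?thesis
        using pw(1)[OF inv, of "nat (- n)"]
        by (intro surj[OF pw(2,3)[OF inv, of "nat (- n)"]]) (simp only:)
    qed
  qed
  moreover have "separates \<mu>"
  proof -
    have "\<mu> (of_poly V C b) < \<mu> (of_poly V C r)" if "r \<in> {r1, r2}" "b \<in> {b1, b2}" for r b
    proof -
      have rb: "r \<in> {r1, r2, b1, b2}" "b \<in> {r1, r2, b1, b2}"
        using that by auto
      obtain m n where mn: "\<nu> (of_poly V C r) = of_int m * g" "\<nu> (of_poly V C b) = of_int n * g"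
        using poly_order[OF edge_closed[OF rb(1)] nz_unit[OF rb(1)]]
          poly_order[OF edge_closed[OF rb(2)] nz_unit[OF rb(2)]] by blast
      have "\<nu> (of_poly V C b) < \<nu> (of_poly V C r)"
        using assms(3) that unfolding separates_def by blast
      then have "n < m"
        using g mn by simp
      then show ?thesis
        using poly[OF edge_closed[OF rb(1)] nz_unit[OF rb(1)]]
          poly[OF edge_closed[OF rb(2)] nz_unit[OF rb(2)]] g mn by (simp add: \<mu>_def)
    qed
    then show ?thesis
      unfolding separates_def by blast
  qed
  ultimately have "\<mu> \<in> Val V C" "separates \<mu>"
    by (simp_all add: Val_def F_def)
  then show ?thesis
    by blast
qed

end

section \<open>Four-cycles\<close>

definition edge_fun :: "'v \<times> 'v \<Rightarrow> 'v point \<Rightarrow> complex" where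
  "edge_fun p \<rho> = (fst (\<rho> (snd p)) - fst (\<rho> (fst p))) + \<i> * (snd (\<rho> (snd p)) - snd (\<rho> (fst p)))"

text \<open>The coordinates themselves are complex, so this is not the complex conjugate of
  \<open>edge_fun\<close> but the formal one, with \<i> replaced by its negative.\<close>

definition conj_edge_fun :: "'v \<times> 'v \<Rightarrow> 'v point \<Rightarrow> complex" where
  "conj_edge_fun p \<rho> =
    (fst (\<rho> (snd p)) - fst (\<rho> (fst p))) - \<i> * (snd (\<rho> (snd p)) - snd (\<rho> (fst p)))"

abbreviation edge_of :: "'v \<times> 'v \<Rightarrow> 'v set" where
  "edge_of p \<equiv> {fst p, snd p}"

lemma W_eq: "W V C u v = of_poly V C (edge_fun (u, v))"
  by (simp add: W_def edge_fun_def[abs_def])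

lemma edge_fun_swap: "edge_fun (v, u) = (\<lambda>\<rho>. - edge_fun (u, v) \<rho>)"
  by (simp add: edge_fun_def fun_eq_iff algebra_simps)

lemma edge_fun_mult_conj:
  "edge_fun p \<rho> * conj_edge_fun p \<rho> =
    (fst (\<rho> (fst p)) - fst (\<rho> (snd p)))\<^sup>2 + (snd (\<rho> (fst p)) - snd (\<rho> (snd p)))\<^sup>2"
  by (simp add: edge_fun_def conj_edge_fun_def power2_eq_square algebra_simps)

lemma edge_fun_polys:
  assumes "fst p \<in> V" "snd p \<in> V"
  shows "edge_fun p \<in> polys V" "conj_edge_fun p \<in> polys V"
proof -
  have c: "(\<lambda>\<rho>. fst (\<rho> (snd p)) - fst (\<rho> (fst p))) \<in> polys V"
    "(\<lambda>\<rho>. \<i> * (snd (\<rho> (snd p)) - snd (\<rho> (fst p)))) \<in> polys V"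
    using assms by (intro polys_diff polys.intros; simp)+
  show "edge_fun p \<in> polys V" "conj_edge_fun p \<in> polys V"
    using polys.add[OF c] polys_diff[OF c] unfolding edge_fun_def[abs_def] conj_edge_fun_def[abs_def]
    by simp_all
qed

text \<open>Two disjoint subsets with at least two elements each exhaust a set of four. The position
  of the red edges on the cycle is left open.\<close>

lemma two_red_two_blue:
  fixes E :: "('v \<times> 'v) set"
  assumes "finite E" "card E = 4" "2 \<le> card {p \<in> E. \<delta> p = Red}" "2 \<le> card {p \<in> E. \<delta> p = Blue}"
  obtains e1 e2 e3 e4 where "distinct [e1, e2, e3, e4]" "E = {e1, e2, e3, e4}"
    "\<delta> e1 = Red" "\<delta> e2 = Red" "\<delta> e3 = Blue" "\<delta> e4 = Blue"
proof -
  have split: "E = {p \<in> E. \<delta> p = Red} \<union> {p \<in> E. \<delta> p = Blue}"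
    using color.exhaust by auto
  have "card E = card {p \<in> E. \<delta> p = Red} + card {p \<in> E. \<delta> p = Blue}"
    using assms(1) by (subst split, subst card_Un_disjoint) auto
  then have "card {p \<in> E. \<delta> p = Red} = 2" "card {p \<in> E. \<delta> p = Blue} = 2"
    using assms by linarith+
  then obtain e1 e2 e3 e4 where *: "{p \<in> E. \<delta> p = Red} = {e1, e2}" "e1 \<noteq> e2"
      "{p \<in> E. \<delta> p = Blue} = {e3, e4}" "e3 \<noteq> e4"
    unfolding card_2_iff by blast
  then have c: "\<delta> e1 = Red" "\<delta> e2 = Red" "\<delta> e3 = Blue" "\<delta> e4 = Blue"
    by blast+
  moreover have "E = {e1, e2, e3, e4}"
    using split unfolding *(1,3) by auto
  moreover have "distinct [e1, e2, e3, e4]"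
    using *(2,4) c by auto
  ultimately show ?thesis
    using that by blast
qed

text \<open>The sum runs over its support, which the assumptions reduce to a single
  valuation.\<close>

lemma mu_eq_one:
  assumes nonzero: "\<And>\<nu>. \<nu> \<in> Val (verts G) C \<Longrightarrow> gap G C \<delta> \<nu> \<noteq> 0 \<longleftrightarrow> P \<nu>"
    and ex: "\<exists>\<nu>\<in>Val (verts G) C. P \<nu>"
    and unique: "\<And>\<nu> \<mu>. \<nu> \<in> Val (verts G) C \<Longrightarrow> P \<nu> \<Longrightarrow> \<mu> \<in> Val (verts G) C \<Longrightarrow> P \<mu> \<Longrightarrow> \<nu> = \<mu>"
    and one: "\<And>\<nu>. \<nu> \<in> Val (verts G) C \<Longrightarrow> P \<nu> \<Longrightarrow> gap G C \<delta> \<nu> = 1"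
  shows "mu G C \<delta> = 1"
proof -
  obtain \<nu> where \<nu>: "\<nu> \<in> Val (verts G) C" "P \<nu>"
    using ex by blast
  have "{\<nu> \<in> Val (verts G) C. gap G C \<delta> \<nu> \<noteq> 0} = {\<nu>}"
  proof (rule Set.set_eqI)
    fix \<mu>
    show "\<mu> \<in> {\<nu> \<in> Val (verts G) C. gap G C \<delta> \<nu> \<noteq> 0} \<longleftrightarrow> \<mu> \<in> {\<nu>}"
      using nonzero[of \<mu>] unique[OF \<nu>, of \<mu>] nonzero[OF \<nu>(1)] \<nu> by auto
  qed
  then show ?thesis
    using one[OF \<nu>] by (simp add: mu_def)
qed

lemma cycle_C4:
  assumes "distinct [v1, v2, v3, v4]"
  shows "cycle (C4 v1 v2 v3 v4) [v1, v2, v3, v4]"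
proof -
  have "{[v1, v2, v3, v4] ! i, [v1, v2, v3, v4] ! (Suc i mod 4)} \<in> edges (C4 v1 v2 v3 v4)"
    if "i < 4" for i
  proof -
    have "i = 0 \<or> i = Suc 0 \<or> i = Suc (Suc 0) \<or> i = Suc (Suc (Suc 0))"
      using that by arith
    then show ?thesis
      by (elim disjE) (simp_all add: C4_def)
  qed
  then show ?thesis
    using assms by (simp add: cycle_def C4_def)
qed

lemma cycle_edges_C4: "cycle_edges [v1, v2, v3, v4] = {{v1, v2}, {v2, v3}, {v3, v4}, {v4, v1}}"
proof -
  have "{..<4::nat} = {0, Suc 0, Suc (Suc 0), Suc (Suc (Suc 0))}"
    by (simp add: numeral_eq_Suc lessThan_Suc insert_commute)
  moreover have "cycle_edges [v1, v2, v3, v4]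
      = (\<lambda>i. {[v1, v2, v3, v4] ! i, [v1, v2, v3, v4] ! (Suc i mod 4)}) ` {..<4}"
    unfolding cycle_edges_def by auto
  ultimately show ?thesis
    by simp
qed

theorem theorem3p7:
  fixes v1 v2 v3 v4 u' v' :: 'v
    and lam :: "'v set \<Rightarrow> real"
    and C :: "'v point set"
    and \<delta> :: "'v set \<Rightarrow> color"
  assumes "distinct [v1, v2, v3, v4]"
    and "labeling (C4 v1 v2 v3 v4) lam"
    and "{u', v'} \<in> edges (C4 v1 v2 v3 v4)"
    and "algebraic_motion (C4 v1 v2 v3 v4) lam u' v' C"
    and "NAC_coloring (C4 v1 v2 v3 v4) \<delta>"
    and "active (C4 v1 v2 v3 v4) C \<delta>"
  shows "mu (C4 v1 v2 v3 v4) C \<delta> = 1"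
proof -
  define G where "G = C4 v1 v2 v3 v4"
  define V where "V = verts G"
  \<comment> \<open>The pairs orient the edges around the cycle, so that differences along them
    telescope to zero; \<open>edge_of\<close> forgets the orientation.\<close>
  define E where "E = {(v1, v2), (v2, v3), (v3, v4), (v4, v1)}"
  have V: "V = {v1, v2, v3, v4}"
    by (simp add: V_def G_def C4_def)
  have edges: "edges G = edge_of ` E"
    by (simp add: G_def C4_def E_def)
  have E_V: "fst p \<in> V" "snd p \<in> V" if "p \<in> E" for p
    using that by (auto simp: E_def V)
  have cardE: "card E = 4" "finite E" and inj: "inj_on edge_of E"
    using assms(1) by (auto simp: E_def inj_on_def doubleton_eq_iff)
  have irr: "irreducible_set V C" and real: "C \<subseteq> realizations G lam u' v'"
    using assms(4) by (simp_all add: algebraic_motion_def irreducible_curve_def V_def G_def)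

  \<comment> \<open>The colors of the four edges\<close>
  let ?cyc = "[v1, v2, v3, v4]"
  have cycle: "cycle G ?cyc" and cyc_edges: "cycle_edges ?cyc = edge_of ` E"
    using cycle_C4[OF assms(1)] cycle_edges_C4[of v1 v2 v3 v4] by (simp_all add: G_def E_def)
  have nac: "\<delta> ` edges G = {Red, Blue}"
    "(\<exists>c. \<forall>e\<in>cycle_edges ?cyc. \<delta> e = c) \<or> (\<forall>c. 2 \<le> card {e \<in> cycle_edges ?cyc. \<delta> e = c})"
    using assms(5) cycle unfolding NAC_coloring_def G_def by blast+
  \<comment> \<open>Both colors occur on the cycle, so it is not monochromatic and the other
    alternative for a NAC-coloring holds. Injectivity of \<open>edge_of\<close> carries the count
    from edges to pairs.\<close>
  have card_color: "2 \<le> card {p \<in> E. \<delta> (edge_of p) = c}" for c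
  proof -
    have "\<not> (\<exists>c. \<forall>e\<in>cycle_edges ?cyc. \<delta> e = c)"
    proof
      assume "\<exists>c. \<forall>e\<in>cycle_edges ?cyc. \<delta> e = c"
      then obtain c where "\<delta> ` edges G \<subseteq> {c}"
        unfolding cyc_edges edges by blast
      then show False
        unfolding nac(1) by auto
    qed
    then have "2 \<le> card {e \<in> edge_of ` E. \<delta> e = c}"
      using nac(2) unfolding cyc_edges by blast
    also have "{e \<in> edge_of ` E. \<delta> e = c} = edge_of ` {p \<in> E. \<delta> (edge_of p) = c}"
      by auto
    also have "card \<dots> = card {p \<in> E. \<delta> (edge_of p) = c}"
      using inj by (intro card_image) (auto simp: inj_on_def)
    finally show ?thesis .
  qed
  obtain e1 e2 e3 e4 where e: "distinct [e1, e2, e3, e4]" "E = {e1, e2, e3, e4}"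
    "\<delta> (edge_of e1) = Red" "\<delta> (edge_of e2) = Red" "\<delta> (edge_of e3) = Blue" "\<delta> (edge_of e4) = Blue"
    using two_red_two_blue[OF cardE(2,1) card_color card_color] by metis

  \<comment> \<open>The two equations satisfied by the edge functions\<close>
  define l where "l p = (complex_of_real (lam (edge_of p)))\<^sup>2" for p :: "'v \<times> 'v"
  have l_nz: "l p \<noteq> 0" if "p \<in> E" for p
  proof -
    have "lam (edge_of p) > 0"
      using assms(2) that edges unfolding labeling_def G_def[symmetric] by blast
    then show ?thesis
      by (simp add: l_def)
  qed
  have norm_eq: "edge_fun p \<rho> * conj_edge_fun p \<rho> = l p" if "p \<in> E" "\<rho> \<in> C" for p \<rho>
  proof -
    have "{fst p, snd p} \<in> edges G"
      using that(1) by (simp add: edges)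
    then show ?thesis
      using real that(2) unfolding edge_fun_mult_conj l_def realizations_def by blast
  qed
  have unit: "edge_fun p \<rho> \<noteq> 0" if "p \<in> E" "\<rho> \<in> C" for p \<rho>
    using norm_eq[OF that] l_nz[OF that(1)] by auto
  have inverse_edge: "inverse (edge_fun p \<rho>) = conj_edge_fun p \<rho> / l p" if "p \<in> E" "\<rho> \<in> C" for p \<rho>
    using norm_eq[OF that] l_nz[OF that(1)] unit[OF that] by (simp add: field_simps)
  \<comment> \<open>The coloring lists the edges in an unknown order, but a sum over
    \<open>E\<close> can be rearranged into cyclic order, where it telescopes.\<close>
  have four_sum: "f e1 + f e2 + f e3 + f e4 = f (v1, v2) + f (v2, v3) + f (v3, v4) + f (v4, v1)"
    for f :: "'v \<times> 'v \<Rightarrow> complex"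
  proof -
    have "sum f {e1, e2, e3, e4} = sum f {(v1, v2), (v2, v3), (v3, v4), (v4, v1)}"
      using e(2) E_def by simp
    then show ?thesis
      using e(1) assms(1) by (simp add: add.assoc)
  qed
  \<comment> \<open>On \<open>C\<close> the inverse is the conjugate expression divided by a nonzero
    constant, hence polynomial.\<close>
  have inverse_regular: "(\<lambda>\<rho>. inverse (edge_fun p \<rho>)) \<in> regular V C" if "p \<in> E" for p
    unfolding regular_iff
    using polys.mult[OF polys.const[of "inverse (l p)"] edge_fun_polys(2)[OF E_V[OF that]]]
      inverse_edge[OF that]
    by (intro bexI) (auto simp: divide_inverse)
  have edge_regular: "edge_fun p \<in> regular V C" if "p \<in> E" for p
    using edge_fun_polys(1)[OF E_V[OF that]] polys_subset_regular by (rule subsetD[rotated])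
  have eE: "e1 \<in> E" "e2 \<in> E" "e3 \<in> E" "e4 \<in> E"
    unfolding e(2) by simp_all
  interpret function_ring C "regular V C"
    using irr by (rule function_ring_regular)
  interpret quadrilateral C "regular V C" "edge_fun e1" "edge_fun e2" "edge_fun e3" "edge_fun e4"
    "l e1" "l e2" "l e3" "l e4"
  proof
    show "f \<rho> \<noteq> 0" if "f \<in> {edge_fun e1, edge_fun e2, edge_fun e3, edge_fun e4}" "\<rho> \<in> C" for f \<rho>
      using that unit[OF eE(1)] unit[OF eE(2)] unit[OF eE(3)] unit[OF eE(4)] by auto
    show "f \<in> regular V C" if "f \<in> {edge_fun e1, edge_fun e2, edge_fun e3, edge_fun e4}" for f
      using that edge_regular[OF eE(1)] edge_regular[OF eE(2)] edge_regular[OF eE(3)]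
        edge_regular[OF eE(4)] by auto
    show "(\<lambda>\<rho>. inverse (f \<rho>)) \<in> regular V C"
      if "f \<in> {edge_fun e1, edge_fun e2, edge_fun e3, edge_fun e4}" for f
      using that inverse_regular[OF eE(1)] inverse_regular[OF eE(2)] inverse_regular[OF eE(3)]
        inverse_regular[OF eE(4)] by auto
    show "l e1 \<noteq> 0" "l e2 \<noteq> 0" "l e3 \<noteq> 0" "l e4 \<noteq> 0"
      by (intro l_nz eE)+
  next
    fix \<rho> assume \<rho>: "\<rho> \<in> C"
    show "edge_fun e1 \<rho> + edge_fun e2 \<rho> + edge_fun e3 \<rho> + edge_fun e4 \<rho> = 0"
      unfolding four_sum[of "\<lambda>p. edge_fun p \<rho>"] by (simp add: edge_fun_def algebra_simps)
    have "l p / edge_fun p \<rho> = conj_edge_fun p \<rho>" if "p \<in> E" for p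
      using norm_eq[OF that \<rho>] unit[OF that \<rho>] by (simp add: field_simps)
    then have "l e1 / edge_fun e1 \<rho> + l e2 / edge_fun e2 \<rho> + l e3 / edge_fun e3 \<rho> + l e4 / edge_fun e4 \<rho>
      = conj_edge_fun e1 \<rho> + conj_edge_fun e2 \<rho> + conj_edge_fun e3 \<rho> + conj_edge_fun e4 \<rho>"
      by (simp only: eE)
    then show "l e1 / edge_fun e1 \<rho> + l e2 / edge_fun e2 \<rho> + l e3 / edge_fun e3 \<rho>
      + l e4 / edge_fun e4 \<rho> = 0"
      unfolding four_sum[of "\<lambda>p. conj_edge_fun p \<rho>"] by (simp add: conj_edge_fun_def algebra_simps)
  qed

  \<comment> \<open>Polynomial functions as Laurent expressions in \<open>q\<close>\<close>
  have edge_set: "edge_fun p \<in> {edge_fun e1, edge_fun e2, edge_fun e3, edge_fun e4}" if "p \<in> E" for p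
    using that e(2) by blast
  have fixed: "\<rho> u' = (0, 0)" "\<rho> v' = (complex_of_real (lam {u', v'}), 0)" if "\<rho> \<in> C" for \<rho>
    using that real by (auto simp: realizations_def)
  obtain p0 where p0: "p0 \<in> E" "edge_of p0 = {u', v'}"
    using assms(3) edges unfolding G_def by auto
  \<comment> \<open>The fixed edge lies on the x-axis, so \<open>a\<close> is its length up to a
    sign that depends on the orientation of \<open>p0\<close>.\<close>
  obtain a where a: "\<And>\<rho>. \<rho> \<in> C \<Longrightarrow> edge_fun p0 \<rho> = a"
  proof -
    have "p0 = (u', v') \<or> p0 = (v', u')"
      using p0(2) by (cases p0) (auto simp: doubleton_eq_iff)
    then have "edge_fun p0 \<rho> = (if p0 = (u', v') then complex_of_real (lam {u', v'})
        else - complex_of_real (lam {u', v'}))" if "\<rho> \<in> C" for \<rho>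
      using fixed[OF that] by (auto simp: edge_fun_def)
    then show ?thesis
      by (rule that)
  qed
  have W_laurent: "laurent (edge_fun p)" "laurent (conj_edge_fun p)" if "p \<in> E" for p
  proof -
    note L = laurent_edges[OF edge_set[OF p0(1)] a edge_set[OF that]]
    show "laurent (edge_fun p)"
      by (rule L)
    show "laurent (conj_edge_fun p)"
      by (rule laurent_cong[OF laurent_mult[OF laurent_const[of "l p"] L(2)]])
        (use inverse_edge[OF that] l_nz[OF that] in auto)
  qed
  have laurent_diff: "laurent f \<longleftrightarrow> laurent g" if "laurent (\<lambda>\<rho>. g \<rho> - f \<rho>)" for f g
  proof
    assume "laurent f"
    from laurent_add[OF this that] show "laurent g"
      by (rule laurent_cong) simp
  next
    assume "laurent g"
    from laurent_add[OF this laurent_mult[OF laurent_const[of "-1"] that]] show "laurent f"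
      by (rule laurent_cong) simp
  qed
  \<comment> \<open>Along an edge the coordinate differences are half the sum of
    \<open>edge_fun\<close> and its conjugate, and their difference divided by
    \<open>2 * \<i>\<close>; both are Laurent. So membership in \<open>L\<close> passes between
    neighbors, and from \<open>u'\<close>, with coordinates 0, it reaches all vertices along the
    path from \<open>v1\<close> to \<open>v4\<close>.\<close>
  define L where "L = {w. laurent (\<lambda>\<rho>. fst (\<rho> w)) \<and> laurent (\<lambda>\<rho>. snd (\<rho> w))}"
  have step: "fst p \<in> L \<longleftrightarrow> snd p \<in> L" if "p \<in> E" for p
  proof -
    have "laurent (\<lambda>\<rho>. fst (\<rho> (snd p)) - fst (\<rho> (fst p)))"
      by (rule laurent_cong[OF laurent_mult[OF laurent_const[of "1/2"]
              laurent_add[OF W_laurent[OF that]]]])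
        (simp add: edge_fun_def conj_edge_fun_def)
    moreover have "laurent (\<lambda>\<rho>. snd (\<rho> (snd p)) - snd (\<rho> (fst p)))"
      by (rule laurent_cong[OF laurent_mult[OF laurent_const[of "- \<i> / 2"]
              laurent_add[OF W_laurent(1)[OF that]
                laurent_mult[OF laurent_const[of "-1"] W_laurent(2)[OF that]]]]])
        (simp add: edge_fun_def conj_edge_fun_def algebra_simps)
    ultimately show ?thesis
      unfolding L_def by (auto dest: laurent_diff)
  qed
  have "u' \<in> L"
    unfolding L_def by (intro CollectI conjI laurent_cong[OF laurent_const[of 0]]) (simp_all add: fixed(1))
  moreover have "u' \<in> V"
    using p0 E_V[OF p0(1)] by (metis insertCI insertE singletonD)
  ultimately have V_L: "V \<subseteq> L"
    using step[of "(v1, v2)"] step[of "(v2, v3)"] step[of "(v3, v4)"] by (auto simp: E_def V)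
  have poly_laurent: "laurent f" if "f \<in> polys V" for f
    using that
  proof (induction rule: polys.induct)
    case (xcoord w)
    then show ?case
      using V_L by (auto simp: L_def)
  next
    case (ycoord w)
    then show ?case
      using V_L by (auto simp: L_def)
  qed (simp_all add: laurent_const laurent_add laurent_mult)
  interpret coupled_motion V C "edge_fun e1" "edge_fun e2" "edge_fun e3" "edge_fun e4"
    "l e1" "l e2" "l e3" "l e4"
  proof
    show "irreducible_set V C"
      by (rule irr)
    show "laurent f" if f: "f \<in> regular V C" for f
    proof -
      obtain p where "p \<in> polys V" "\<forall>\<rho>\<in>C. f \<rho> = p \<rho>"
        using f unfolding regular_iff by blast
      then show ?thesis
        using laurent_cong[OF poly_laurent[of p], of f] by simp
    qed
  qed

  \<comment> \<open>The gap in terms of four values\<close>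
  have val_sets: "{\<nu> (W V C u v) |u v. {u, v} \<in> edges G \<and> \<delta> {u, v} = c}
      = (\<lambda>p. \<nu> (of_poly V C (edge_fun p))) ` {p \<in> E. \<delta> (edge_of p) = c}" (is "?A = ?B")
    if "\<nu> \<in> Val V C" for \<nu> c
  proof -
    interpret fun_valuation C "regular V C" "\<lambda>f. rat_of_int (\<nu> (of_poly V C f))"
      using that by (intro fun_valuation_of_poly[OF irr]) (auto simp: Val_def mono_def)
    \<comment> \<open>The sets in \<open>gap\<close> contain both orientations of each edge.
      Reversal only changes the sign of the edge function and not its value, so the pairs in
      \<open>E\<close> give all values.\<close>
    have swap: "\<nu> (of_poly V C (edge_fun (snd p, fst p))) = \<nu> (of_poly V C (edge_fun p))"
      if "p \<in> E" for p
    proof -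
      have "rat_of_int (\<nu> (of_poly V C (edge_fun (snd p, fst p)))) = of_int (\<nu> (of_poly V C (edge_fun p)))"
        using val_uminus[OF edge_closed[OF edge_set[OF that]] nz_unit[OF edge_set[OF that]]]
        unfolding edge_fun_swap[of "snd p" "fst p"] by simp
      then show ?thesis
        by simp
    qed
    have "?A \<subseteq> ?B"
    proof
      fix x assume "x \<in> ?A"
      then obtain u v where uv: "x = \<nu> (W V C u v)" "{u, v} \<in> edges G" "\<delta> {u, v} = c"
        by blast
      then obtain p where p: "p \<in> E" "{u, v} = edge_of p"
        unfolding edges by blast
      then have "(u, v) = p \<or> (u, v) = (snd p, fst p)"
        by (cases p) (auto simp: doubleton_eq_iff)
      then have "x = \<nu> (of_poly V C (edge_fun p))"
        using swap[OF p(1)] uv(1) by (auto simp: W_eq)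
      moreover have "p \<in> {p \<in> E. \<delta> (edge_of p) = c}"
        using p uv(3) by simp
      ultimately show "x \<in> ?B"
        by (rule image_eqI)
    qed
    moreover have "?B \<subseteq> ?A"
    proof
      fix x assume "x \<in> ?B"
      then obtain p where p: "x = \<nu> (of_poly V C (edge_fun p))" "p \<in> E" "\<delta> (edge_of p) = c"
        by (elim imageE CollectE conjE)
      then have "x = \<nu> (W V C (fst p) (snd p))" "{fst p, snd p} \<in> edges G"
        by (simp_all add: W_eq edges)
      then show "x \<in> ?A"
        using p(3) by blast
    qed
    ultimately show ?thesis
      by blast
  qed
  have red: "{p \<in> E. \<delta> (edge_of p) = Red} = {e1, e2}" and blue: "{p \<in> E. \<delta> (edge_of p) = Blue} = {e3, e4}"
    using e by auto
  have gap: "gap G C \<delta> \<nu> = max 0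
      (min (\<nu> (of_poly V C (edge_fun e1))) (\<nu> (of_poly V C (edge_fun e2)))
       - max (\<nu> (of_poly V C (edge_fun e3))) (\<nu> (of_poly V C (edge_fun e4))))"
    if "\<nu> \<in> Val V C" for \<nu>
    unfolding gap_def V_def[symmetric] val_sets[OF that] red blue by simp
  \<comment> \<open>Because of the cutoff at 0, a nonzero gap is a positive one: the smaller red
    value exceeds the larger blue value.\<close>
  have gap_nonzero: "gap G C \<delta> \<nu> \<noteq> 0 \<longleftrightarrow> separates \<nu>" if "\<nu> \<in> Val V C" for \<nu>
    unfolding gap[OF that] separates_def by auto
  have gap_one: "gap G C \<delta> \<nu> = 1" if "\<nu> \<in> Val V C" "separates \<nu>" for \<nu>
    unfolding gap[OF that(1)] using Val_edges[OF that] by simp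

  \<comment> \<open>From activity to a normalized valuation\<close>
  have ex: "\<exists>\<nu>\<in>Val V C. separates \<nu>"
  proof -
    obtain \<nu> and \<alpha> :: rat where \<nu>: "valuation (function_field V C) \<nu>" "trivial_on_constants V C \<nu>"
        "\<forall>u v. {u, v} \<in> edges G \<longrightarrow> (\<delta> {u, v} = Red \<longleftrightarrow> \<nu> (W V C u v) > \<alpha>)"
      using assms(6) unfolding active_def G_def[symmetric] V_def[symmetric] by blast
    \<comment> \<open>The threshold gives strict separation: blue values are at most \<alpha>, red
      values exceed it.\<close>
    have "\<delta> (edge_of p) = Red \<longleftrightarrow> \<nu> (of_poly V C (edge_fun p)) > \<alpha>" if "p \<in> E" for p
      using \<nu>(3)[rule_format, of "fst p" "snd p"] that by (simp add: edges W_eq)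
    from this[of e1] this[of e2] this[of e3] this[of e4] have "separates \<nu>"
      unfolding separates_def using e by auto
    with \<nu>(1,2) show ?thesis
      by (rule Val_exists)
  qed
  show ?thesis
    unfolding G_def[symmetric]
    by (rule mu_eq_one[of G C \<delta> separates])
      (use gap_nonzero gap_one ex Val_unique in \<open>auto simp: V_def\<close>)
qed

end
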